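(* Let $\mathcal{C}=(F_v,F_e,\mathbb{Z}^d)$ be a crystal framework in $\mathbb{R}^d$ with associated symbol function $\Phi(z)$ and suppose that $\mathcal{C}$ has no nonzero internal (finitely supported) self-stresses and no nonzero internal (finitely supported) infinitesimal flexes. Then (i) $d|F_v|=|F_e|$, the matricial symbol function $\Phi(z)$ on the $d$-torus is square with full rank almost everywhere, and $\mathcal{C}$ is square-summably isostatic; (ii) nonzero infinitesimal wave flexes (1-cell periodic modulo phase) with phase factor $\omega\in\mathbb{T}^d$ exist if and only if $\det\Phi(\omega)=0$. In this case the dimension of the corresponding space of wave flexes is $\dim\ker\Phi(\omega)$.
   Context: A crystal framework $\mathcal{C}=(F_v,F_e,\mathbb{Z}^d)$ in $\mathbb{R}^d$ is a connected countable bar-joint framework $(G,p)$, $G=(V,E)$ simple, edges of nonzero length, together with a discrete group of translations $T_n$ ($n\in\mathbb{Z}^d$, $T_nx=x+n_1a_1+\cdots+n_da_d$ with $a_1,\dots,a_d$ linearly independent), a finite connected set $F_e$ of framework edges and a finite set $F_v$ of framework vertices (contained in the vertex set of $F_e$) such that the translates of $F_e$ (resp. $F_v$) under the $T_n$ are disjoint with union all framework edges (resp. vertices). The vertex $T_n\kappa$ is written $\kappa+n$. The rigidity matrix $R$ acts by $(Ru)_e=(p_v-p_w)\cdot(u_v-u_w)$ for an edge $e=vw$ (real dot product extended bilinearly to $\mathbb{C}^d$). An infinitesimal flex is $u=(u_v)_{v\in V}$, $u_v\in\mathbb{C}^d$, with $Ru=0$; a self-stress is $s=(s_e)_{e\in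 E}$ with $R^ts=0$ ($R^t$ the transpose). Square-summably isostatic: no nonzero square-summable infinitesimal flex and no nonzero square-summable self-stress. A wave flex with phase factor $\omega\in\mathbb{T}^d$ is an infinitesimal flex with $u_{\kappa+n}=\omega_1^{n_1}\cdots\omega_d^{n_d}u_\kappa$ for all $\kappa\in F_v$, $n\in\mathbb{Z}^d$. The matricial symbol function $\Phi:\mathbb{T}^d\to M_{|F_e|,d|F_v|}(\mathbb{C})$ has rows indexed by $F_e$ and columns by pairs (motif vertex, coordinate direction): for $e\in F_e$ joining $\kappa+m$ and $\tau+n$ ($\kappa,\tau\in F_v$), with $v_e=p_{\kappa+m}-p_{\tau+n}$, row $e$ is the sum of the row with $\bar z^{m}v_e$ in the columns of $\kappa$ and the row with $-\bar z^{n}v_e$ in the columns of $\tau$, with zeros elsewhere, where $\bar z^{m}=\bar z_1^{m_1}\cdots\bar z_d^{m_d}$. *)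

theory Defs
  imports
    "HOL-Analysis.Analysis"
    "HOL-Library.Function_Algebras"
    "Jordan_Normal_Form.Matrix_Kernel"
    "Jordan_Normal_Form.DL_Rank"
begin

no_notation Matrix.vec_index (infixl "$" 100)

subsection \<open>Bar-joint frameworks\<close>

definition simple_graph :: "'v set \<Rightarrow> 'v set set \<Rightarrow> bool" where
  "simple_graph V E \<longleftrightarrow> (\<forall>e\<in>E. \<exists>v w. v \<in> V \<and> w \<in> V \<and> v \<noteq> w \<and> e = {v, w})"

definition connected_graph :: "'v set \<Rightarrow> 'v set set \<Rightarrow> bool" where
  "connected_graph V E \<longleftrightarrow> (\<forall>v\<in>V. \<forall>w\<in>V. (v, w) \<in> {(x, y). {x, y} \<in> E}\<^sup>*)"

definition bar_joint_framework ::
    "'v set \<Rightarrow> 'v set set \<Rightarrow> ('v \<Rightarrow> real ^ 'd) \<Rightarrow> bool" where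
  "bar_joint_framework V E p \<longleftrightarrow>
     simple_graph V E \<and> (\<forall>v w. {v, w} \<in> E \<and> v \<noteq> w \<longrightarrow> p v \<noteq> p w)"

subsection \<open>Crystal frameworks\<close>

definition lattice_vec :: "('d \<Rightarrow> real ^ 'd) \<Rightarrow> int ^ 'd \<Rightarrow> real ^ 'd" where
  "lattice_vec a n = (\<Sum>i\<in>UNIV. of_int (n $ i) *\<^sub>R a i)"

text \<open>
  The translation group acts on the abstract vertices by \<open>T\<close>, so that \<open>T n \<kappa>\<close> is the vertex
  \<open>\<kappa> + n\<close>, and on an edge \<open>e = {v, w}\<close> by taking the image \<open>T n ` e\<close>. The placement \<open>p\<close>
  intertwines \<open>T n\<close> with translation by \<open>n\<^sub>1 a\<^sub>1 + \<dots> + n\<^sub>d a\<^sub>d\<close>. If \<open>p\<close> is injective,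
  then \<open>T\<close> is determined on \<open>V\<close> by the translations; \<open>p\<close> is not required to be injective.
\<close>

locale crystal_framework =
  fixes V :: "'v set"
    and E :: "'v set set"
    and p :: "'v \<Rightarrow> real ^ 'd"
    and a :: "'d \<Rightarrow> real ^ 'd"
    and T :: "int ^ 'd \<Rightarrow> 'v \<Rightarrow> 'v"
    and F\<^sub>v :: "'v set"
    and F\<^sub>e :: "'v set set"
  assumes framework: "bar_joint_framework V E p"
    and countable_V: "countable V"
    and connected: "connected_graph V E"
    and independent_periods: "inj a" "independent (range a)"
    and action_zero: "v \<in> V \<Longrightarrow> T 0 v = v"
    and action_add: "v \<in> V \<Longrightarrow> T (m + n) v = T m (T n v)"
    and action_translation: "v \<in> V \<Longrightarrow> p (T n v) = p v + lattice_vec a n"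
    and F\<^sub>v: "finite F\<^sub>v" "F\<^sub>v \<subseteq> V"
    and F\<^sub>e: "finite F\<^sub>e" "F\<^sub>e \<subseteq> E"
    and connected_F\<^sub>e: "connected_graph (\<Union>F\<^sub>e) F\<^sub>e"
    and F\<^sub>v_subset: "F\<^sub>v \<subseteq> \<Union>F\<^sub>e"
    and disjoint_vertices: "m \<noteq> n \<Longrightarrow> T m ` F\<^sub>v \<inter> T n ` F\<^sub>v = {}"
    and cover_vertices: "(\<Union>n. T n ` F\<^sub>v) = V"
    and disjoint_edges: "m \<noteq> n \<Longrightarrow> (`) (T m) ` F\<^sub>e \<inter> (`) (T n) ` F\<^sub>e = {}"
    and cover_edges: "(\<Union>n. (`) (T n) ` F\<^sub>e) = E"

subsection \<open>The rigidity matrix, flexes and stresses\<close>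

definition cvec :: "real ^ 'd \<Rightarrow> complex ^ 'd" where
  "cvec x = (\<chi> i. complex_of_real (x $ i))"

text \<open>The bilinear (not sesquilinear) extension of the real dot product.\<close>

definition cdot :: "complex ^ 'd \<Rightarrow> complex ^ 'd \<Rightarrow> complex" where
  "cdot x y = (\<Sum>i\<in>UNIV. x $ i * y $ i)"

text \<open>
  The entries of the rigidity matrix in the row of the edge \<open>e\<close> and the \<open>d\<close> columns of the
  vertex \<open>v\<close>. For \<open>e = {v, w}\<close> the sum has the two terms \<open>p v - p v = 0\<close> and \<open>p v - p w\<close>.
\<close>

definition rigidity_entry :: "('v \<Rightarrow> real ^ 'd) \<Rightarrow> 'v set \<Rightarrow> 'v \<Rightarrow> real ^ 'd" where
  "rigidity_entry p e v = (if v \<in> e then (\<Sum>x\<in>e. p v - p x) else 0)"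

definition rigidity_map :: "('v \<Rightarrow> real ^ 'd) \<Rightarrow> ('v \<Rightarrow> complex ^ 'd) \<Rightarrow> 'v set \<Rightarrow> complex" where
  "rigidity_map p u e = (\<Sum>v\<in>e. cdot (cvec (rigidity_entry p e v)) (u v))"

definition rigidity_transpose ::
    "'v set set \<Rightarrow> ('v \<Rightarrow> real ^ 'd) \<Rightarrow> ('v set \<Rightarrow> complex) \<Rightarrow> 'v \<Rightarrow> complex ^ 'd" where
  "rigidity_transpose E p s v = (\<Sum>e | e \<in> E \<and> v \<in> e. s e *s cvec (rigidity_entry p e v))"

lemma rigidity_entry_edge:
  assumes "v \<noteq> w"
  shows "rigidity_entry p {v, w} v = p v - p w"
  using assms by (simp add: rigidity_entry_def)

lemma rigidity_map_edge:
  assumes "v \<noteq> w"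
  shows "rigidity_map p u {v, w} = cdot (cvec (p v - p w)) (u v - u w)"
proof -
  have "rigidity_entry p {v, w} w = p w - p v"
    using rigidity_entry_edge[of w v p] assms by (simp add: insert_commute)
  then have "rigidity_map p u {v, w} =
      cdot (cvec (p v - p w)) (u v) + cdot (cvec (p w - p v)) (u w)"
    using assms by (simp add: rigidity_map_def rigidity_entry_edge)
  also have "\<dots> = cdot (cvec (p v - p w)) (u v - u w)"
    unfolding cdot_def cvec_def sum.distrib[symmetric]
    by (intro sum.cong refl) (simp add: algebra_simps)
  finally show ?thesis .
qed

text \<open>
  Families indexed by \<open>V\<close> or by \<open>E\<close> are functions on the whole type that vanish off the index
  set, so that the zero family is \<open>0\<close>.
\<close>

definition infinitesimal_flex ::
    "'v set \<Rightarrow> 'v set set \<Rightarrow> ('v \<Rightarrow> real ^ 'd) \<Rightarrow> ('v \<Rightarrow> complex ^ 'd) \<Rightarrow> bool" where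
  "infinitesimal_flex V E p u \<longleftrightarrow>
     (\<forall>v. v \<notin> V \<longrightarrow> u v = 0) \<and> (\<forall>e\<in>E. rigidity_map p u e = 0)"

definition self_stress ::
    "'v set \<Rightarrow> 'v set set \<Rightarrow> ('v \<Rightarrow> real ^ 'd) \<Rightarrow> ('v set \<Rightarrow> complex) \<Rightarrow> bool" where
  "self_stress V E p s \<longleftrightarrow>
     (\<forall>e. e \<notin> E \<longrightarrow> s e = 0) \<and> (\<forall>v\<in>V. rigidity_transpose E p s v = 0)"

definition finitely_supported :: "('i \<Rightarrow> 'b::zero) \<Rightarrow> bool" where
  "finitely_supported f \<longleftrightarrow> finite {i. f i \<noteq> 0}"

definition square_summable :: "('i \<Rightarrow> 'b::real_normed_vector) \<Rightarrow> bool" where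
  "square_summable f \<longleftrightarrow> (\<lambda>i. (norm (f i))\<^sup>2) summable_on UNIV"

definition square_summably_isostatic ::
    "'v set \<Rightarrow> 'v set set \<Rightarrow> ('v \<Rightarrow> real ^ 'd) \<Rightarrow> bool" where
  "square_summably_isostatic V E p \<longleftrightarrow>
     (\<forall>u. infinitesimal_flex V E p u \<and> square_summable u \<longrightarrow> u = 0) \<and>
     (\<forall>s. self_stress V E p s \<and> square_summable s \<longrightarrow> s = 0)"

subsection \<open>The torus and wave flexes\<close>

definition torus :: "(complex ^ 'd) set" where
  "torus = {z. \<forall>i. cmod (z $ i) = 1}"

text \<open>Normalised Haar measure on the torus, as a measure on \<open>complex ^ 'd\<close>.\<close>

definition torus_measure :: "(complex ^ 'd) measure" where
  "torus_measure =
     distr (uniform_measure lborel (cbox 0 (\<chi> i. 2 * pi) :: (real ^ 'd) set)) borel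
       (\<lambda>t. \<chi> i. cis (t $ i))"

lemma emeasure_torus_measure:
  "emeasure (torus_measure :: (complex ^ 'd) measure) torus = 1"
proof -
  let ?B = "cbox 0 (\<chi> i. 2 * pi) :: (real ^ 'd) set"
  let ?f = "\<lambda>t :: real ^ 'd. (\<chi> i. cis (t $ i)) :: complex ^ 'd"
  have "continuous_on UNIV ?f"
    by (intro continuous_on_vec_lambda continuous_intros)
  then have [measurable]: "?f \<in> borel_measurable borel"
    by (rule borel_measurable_continuous_onI)
  have "closed (torus :: (complex ^ 'd) set)"
    unfolding torus_def by (intro closed_Collect_all closed_Collect_eq continuous_intros)
  then have torus: "(torus :: (complex ^ 'd) set) \<in> sets borel"
    by simp
  have vimage: "?f -` torus = UNIV"
    by (auto simp: torus_def)
  obtain c where "emeasure lborel ?B = ennreal c" "0 < c"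
  proof
    show "emeasure lborel ?B = ennreal (\<Prod>b\<in>Basis. inner ((\<chi> i. 2 * pi) - 0 :: real ^ 'd) b)"
      by (intro emeasure_lborel_cbox) (auto simp: Basis_vec_def inner_axis)
    show "0 < (\<Prod>b\<in>Basis. inner ((\<chi> i. 2 * pi) - 0 :: real ^ 'd) b)"
      by (intro prod_pos) (auto simp: Basis_vec_def inner_axis)
  qed
  then have "emeasure lborel ?B \<noteq> 0" "emeasure lborel ?B \<noteq> \<infinity>"
    by auto
  then show ?thesis
    unfolding torus_measure_def using torus
    by (subst emeasure_distr) (simp_all add: vimage less_top)
qed

definition monomial :: "complex ^ 'd \<Rightarrow> int ^ 'd \<Rightarrow> complex" where
  "monomial z n = (\<Prod>i\<in>UNIV. z $ i powi n $ i)"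

definition wave_flexes ::
    "'v set \<Rightarrow> 'v set set \<Rightarrow> ('v \<Rightarrow> real ^ 'd) \<Rightarrow> (int ^ 'd \<Rightarrow> 'v \<Rightarrow> 'v) \<Rightarrow> 'v set
      \<Rightarrow> complex ^ 'd \<Rightarrow> ('v \<Rightarrow> complex ^ 'd) set" where
  "wave_flexes V E p T F\<^sub>v \<omega> =
     {u. infinitesimal_flex V E p u \<and> (\<forall>\<kappa>\<in>F\<^sub>v. \<forall>n. u (T n \<kappa>) = monomial \<omega> n *s u \<kappa>)}"

definition scale_field :: "complex \<Rightarrow> ('v \<Rightarrow> complex ^ 'd) \<Rightarrow> 'v \<Rightarrow> complex ^ 'd" where
  "scale_field c u = (\<lambda>v. c *s u v)"

interpretation velocity_fields: vector_space scale_field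
  by unfold_locales
    (auto simp: scale_field_def fun_eq_iff Finite_Cartesian_Product.vec_eq_iff algebra_simps)

lemma rigidity_map_linear:
  fixes p :: "'v \<Rightarrow> real ^ 'd"
  shows "rigidity_map p 0 e = 0"
    and "rigidity_map p (u + w) e = rigidity_map p u e + rigidity_map p w e"
    and "rigidity_map p (scale_field c u) e = c * rigidity_map p u e"
proof -
  have "cdot x (y + z) = cdot x y + cdot x z" "cdot x (c *s y) = c * cdot x y" "cdot x 0 = 0"
    for x y z :: "complex ^ 'd"
    by (simp_all add: cdot_def ring_distribs sum.distrib sum_distrib_left mult.left_commute)
  then show "rigidity_map p 0 e = 0"
    "rigidity_map p (u + w) e = rigidity_map p u e + rigidity_map p w e"
    "rigidity_map p (scale_field c u) e = c * rigidity_map p u e"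
    by (simp_all add: rigidity_map_def scale_field_def sum.distrib sum_distrib_left)
qed

lemma subspace_wave_flexes: "velocity_fields.subspace (wave_flexes V E p T F\<^sub>v \<omega>)"
proof (rule velocity_fields.subspaceI)
  show "0 \<in> wave_flexes V E p T F\<^sub>v \<omega>"
    by (simp add: wave_flexes_def infinitesimal_flex_def rigidity_map_linear)
next
  fix u w
  assume "u \<in> wave_flexes V E p T F\<^sub>v \<omega>" "w \<in> wave_flexes V E p T F\<^sub>v \<omega>"
  then show "u + w \<in> wave_flexes V E p T F\<^sub>v \<omega>"
    by (simp add: wave_flexes_def infinitesimal_flex_def rigidity_map_linear vector_add_ldistrib)
next
  fix c u
  assume "u \<in> wave_flexes V E p T F\<^sub>v \<omega>"
  then show "scale_field c u \<in> wave_flexes V E p T F\<^sub>v \<omega>"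
    by (simp add: wave_flexes_def infinitesimal_flex_def rigidity_map_linear)
      (simp add: scale_field_def mult.commute)
qed

subsection \<open>The matricial symbol function\<close>

text \<open>
  The entries in the row of \<open>e \<in> F\<^sub>e\<close> and the \<open>d\<close> columns of \<open>\<kappa> \<in> F\<^sub>v\<close>: every endpoint of
  \<open>e\<close> of the form \<open>\<kappa> + m\<close> contributes the conjugate of \<open>z\<close> to the power \<open>m\<close> times the vector
  from the other endpoint to \<open>\<kappa> + m\<close>. The lemma \<open>symbol_row_edge\<close> below is the description
  of the row as a sum over the two endpoints.
\<close>

definition symbol_row ::
    "('v \<Rightarrow> real ^ 'd) \<Rightarrow> (int ^ 'd \<Rightarrow> 'v \<Rightarrow> 'v) \<Rightarrow> complex ^ 'd \<Rightarrow> 'v set \<Rightarrow> 'v \<Rightarrow> complex ^ 'd" where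
  "symbol_row p T z e \<kappa> =
     (\<Sum>m | T m \<kappa> \<in> e. monomial (\<chi> i. cnj (z $ i)) m *s cvec (rigidity_entry p e (T m \<kappa>)))"

text \<open>
  \<open>es\<close> and \<open>cs\<close> are enumerations, without repetition, of the row index set \<open>F\<^sub>e\<close> and of the
  column index set \<open>F\<^sub>v \<times> {1..d}\<close>.
\<close>

definition symbol_matrix ::
    "('v \<Rightarrow> real ^ 'd) \<Rightarrow> (int ^ 'd \<Rightarrow> 'v \<Rightarrow> 'v) \<Rightarrow> 'v set list \<Rightarrow> ('v \<times> 'd) list
      \<Rightarrow> complex ^ 'd \<Rightarrow> complex mat" where
  "symbol_matrix p T es cs z =
     Matrix.mat (length es) (length cs)
       (\<lambda>(r, c). symbol_row p T z (es ! r) (fst (cs ! c)) $ snd (cs ! c))"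

definition full_rank :: "complex mat \<Rightarrow> bool" where
  "full_rank A \<longleftrightarrow> vec_space.rank (dim_row A) A = min (dim_row A) (dim_col A)"

context crystal_framework
begin

lemma translate_eq_iff:
  assumes "\<kappa> \<in> F\<^sub>v" "\<tau> \<in> F\<^sub>v"
  shows "T m \<kappa> = T n \<tau> \<longleftrightarrow> m = n \<and> \<kappa> = \<tau>"
proof
  assume *: "T m \<kappa> = T n \<tau>"
  have mn: "m = n"
  proof (rule ccontr)
    assume "m \<noteq> n"
    moreover have "T m \<kappa> \<in> T m ` F\<^sub>v" "T m \<kappa> \<in> T n ` F\<^sub>v"
      using assms * by (blast, metis imageI)
    ultimately show False
      using disjoint_vertices[of m n] by blast
  qed
  have V: "\<kappa> \<in> V" "\<tau> \<in> V"
    using assms F\<^sub>v by auto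
  have "T (- m + m) \<kappa> = T (- m + m) \<tau>"
    using * mn V by (simp only: action_add)
  then show "m = n \<and> \<kappa> = \<tau>"
    using V mn by (simp add: action_zero)
qed auto

lemma symbol_row_edge:
  fixes z :: "complex ^ 'd"
  assumes "\<kappa> \<in> F\<^sub>v" "\<tau> \<in> F\<^sub>v" "\<sigma> \<in> F\<^sub>v" and "T m \<kappa> \<noteq> T n \<tau>"
  defines "v\<^sub>e \<equiv> cvec (p (T m \<kappa>) - p (T n \<tau>))" and "zc \<equiv> (\<chi> i. cnj (z $ i))"
  shows "symbol_row p T z {T m \<kappa>, T n \<tau>} \<sigma> =
    (if \<sigma> = \<kappa> then monomial zc m *s v\<^sub>e else 0) + (if \<sigma> = \<tau> then - monomial zc n *s v\<^sub>e else 0)"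
proof -
  let ?e = "{T m \<kappa>, T n \<tau>}"
  have S: "{k. T k \<sigma> \<in> ?e} = (if \<sigma> = \<kappa> then {m} else {}) \<union> (if \<sigma> = \<tau> then {n} else {})"
    using assms(1-3) by (auto simp: translate_eq_iff)
  have mn: "\<kappa> = \<tau> \<Longrightarrow> m \<noteq> n"
    using assms(4) by auto
  have "rigidity_entry p ?e (T m \<kappa>) = p (T m \<kappa>) - p (T n \<tau>)"
    using assms(4) by (rule rigidity_entry_edge)
  then have m: "cvec (rigidity_entry p ?e (T m \<kappa>)) = v\<^sub>e"
    by (simp add: v\<^sub>e_def)
  have "rigidity_entry p ?e (T n \<tau>) = p (T n \<tau>) - p (T m \<kappa>)"
    using rigidity_entry_edge[OF assms(4)[symmetric], of p] by (simp only: insert_commute)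
  then have n: "cvec (rigidity_entry p ?e (T n \<tau>)) = - v\<^sub>e"
    by (simp add: v\<^sub>e_def cvec_def Finite_Cartesian_Product.vec_eq_iff)
  have neg: "monomial zc n *s (- v\<^sub>e) = - monomial zc n *s v\<^sub>e"
    by (simp add: Finite_Cartesian_Product.vec_eq_iff)
  consider "\<sigma> = \<kappa>" "\<sigma> = \<tau>" | "\<sigma> = \<kappa>" "\<sigma> \<noteq> \<tau>" | "\<sigma> \<noteq> \<kappa>" "\<sigma> = \<tau>"
    | "\<sigma> \<noteq> \<kappa>" "\<sigma> \<noteq> \<tau>"
    by blast
  then show ?thesis
  proof cases
    case 1
    then show ?thesis
      using S mn m n neg by (simp add: symbol_row_def flip: zc_def)
  next
    case 2
    then show ?thesis
      using S m by (simp add: symbol_row_def flip: zc_def)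
  next
    case 3
    then show ?thesis
      using S n neg by (simp add: symbol_row_def flip: zc_def)
  next
    case 4
    then show ?thesis
      using S by (simp add: symbol_row_def)
  qed
qed

end

end

theory Submission
  imports Defs
begin

text \<open>
  The rigidity matrix of a crystal framework commutes with translations and has finite range. It
  is a convolution operator between functions on finitely many copies of \<open>\<int>\<^sup>d\<close>, with symbol
  \<open>\<Phi>\<close> up to complex conjugation, and its transpose is another such operator. The theorem
  comes from one principle, applied to both: if such an operator has no nonzero finitely supported
  kernel element, then its kernel contributes only few dimensions on large boxes.

  The reason is a dimension count. Truncate elements of the kernel to a box of side \<open>L\<close>. The
  operator maps the truncations to functions that live near the boundary of the box, a set of only
  \<open>o(L\<^sup>d)\<close> positions. If the truncations spanned a space of dimension at least \<open>\<epsilon> L\<^sup>d\<close>, some nonzero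
  truncation would be mapped to zero and would be a finitely supported kernel element
  (\<open>vanishing_boundary_values\<close>, \<open>box_boundary_density\<close>).

  A nonzero square-summable kernel element produces that many dimensions through its translates:
  the matrix of the truncated translates has constant diagonal and bounded rows, and
  \<open>\<bar>tr A\<bar>\<^sup>2 \<le> rank A \<cdot> \<parallel>A\<parallel>\<^sup>2\<close> bounds its rank from below (\<open>trace_le_rank_Hilbert_Schmidt\<close>,
  \<open>square_summable_kernel_trivial\<close>). A set of positive measure of points of the torus at which the
  symbol is not injective produces them too: some translate of the grid of \<open>L\<close>-th roots
  of unity meets the set in a positive proportion of its \<open>L\<^sup>d\<close> points, and the corresponding plane
  waves are orthogonal on the box (\<open>emeasure_le_grid_count\<close>, \<open>card_singular_grid_points\<close>,
  \<open>singular_angles_null\<close>).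

  Thus the symbol and the symbol of the transpose are both injective almost everywhere, which makes
  \<open>\<Phi>\<close> square (\<open>Maxwell_count\<close>) and gives full rank almost everywhere, and there are neither
  square-summable flexes nor square-summable stresses. The statements on wave flexes are then linear
  algebra: a wave flex is determined by its amplitudes on the motif, and the condition on these is
  membership in the kernel of the symbol at the phase factor (\<open>amplitude_wave_in_kernel\<close>,
  \<open>kernel_vector_extends_to_wave\<close>).
\<close>

section \<open>Rank and trace\<close>

definition inner_on :: "'j set \<Rightarrow> ('j \<Rightarrow> complex) \<Rightarrow> ('j \<Rightarrow> complex) \<Rightarrow> complex" where
  "inner_on J x y = (\<Sum>j\<in>J. cnj (x j) * y j)"

lemma inner_on_right:
  shows inner_on_diff_right: "inner_on J x (\<lambda>j. y j - z j) = inner_on J x y - inner_on J x z"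
    and inner_on_mult_right: "inner_on J x (\<lambda>j. y j * c) = inner_on J x y * c"
    and inner_on_sum_right: "inner_on J x (\<lambda>j. \<Sum>k\<in>K. f k j) = (\<Sum>k\<in>K. inner_on J x (f k))"
  unfolding inner_on_def
  by (simp_all add: algebra_simps sum_subtractf sum_distrib_left sum_distrib_right sum.swap[of _ K J])

lemma cnj_inner_on: "cnj (inner_on J x y) = inner_on J y x"
  by (simp add: inner_on_def mult.commute)

lemma inner_on_self: "inner_on J x x = of_real (\<Sum>j\<in>J. (cmod (x j))\<^sup>2)"
  by (simp add: inner_on_def mult.commute[of "cnj _"] flip: complex_norm_square)

definition orthonormal_on :: "'j set \<Rightarrow> 'r set \<Rightarrow> ('r \<Rightarrow> 'j \<Rightarrow> complex) \<Rightarrow> bool" where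
  "orthonormal_on J R \<psi> \<longleftrightarrow> (\<forall>r\<in>R. \<forall>s\<in>R. inner_on J (\<psi> r) (\<psi> s) = (if r = s then 1 else 0))"

text \<open>
  \<open>orthogonal_part J R \<psi> x\<close> is the projection of \<open>x\<close> onto the orthogonal complement of the
  span of the \<open>\<psi> s\<close> when these are orthonormal; Bessel's inequality and the Gram--Schmidt step
  both come from computing with it.
\<close>

definition orthogonal_part ::
    "'j set \<Rightarrow> 'r set \<Rightarrow> ('r \<Rightarrow> 'j \<Rightarrow> complex) \<Rightarrow> ('j \<Rightarrow> complex) \<Rightarrow> 'j \<Rightarrow> complex" where
  "orthogonal_part J R \<psi> x = (\<lambda>j. x j - (\<Sum>s\<in>R. \<psi> s j * inner_on J (\<psi> s) x))"

lemma inner_orthogonal_part: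
  assumes "orthonormal_on J R \<psi>" "finite R" "r \<in> R"
  shows "inner_on J (\<psi> r) (orthogonal_part J R \<psi> x) = 0"
proof -
  have "(\<Sum>s\<in>R. inner_on J (\<psi> r) (\<psi> s) * inner_on J (\<psi> s) x) =
      (\<Sum>s\<in>R. if r = s then inner_on J (\<psi> s) x else 0)"
    using assms by (intro sum.cong) (auto simp: orthonormal_on_def)
  then show ?thesis
    using assms
    by (simp add: orthogonal_part_def inner_on_diff_right inner_on_sum_right inner_on_mult_right)
qed

text \<open>
  The squared norm of the orthogonal part is the difference of the two sides.
\<close>

lemma Bessel_inequality:
  assumes on: "orthonormal_on J R \<psi>" and R: "finite R"
  shows "(\<Sum>s\<in>R. (cmod (inner_on J (\<psi> s) x))\<^sup>2) \<le> (\<Sum>j\<in>J. (cmod (x j))\<^sup>2)"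
proof -
  let ?g = "orthogonal_part J R \<psi> x"
  have "inner_on J ?g ?g = inner_on J x ?g - (\<Sum>s\<in>R. cnj (inner_on J (\<psi> s) x) * inner_on J (\<psi> s) ?g)"
    by (subst (1) orthogonal_part_def)
      (simp add: inner_on_def algebra_simps sum_subtractf sum_distrib_left sum_distrib_right
        sum.swap[of _ R J])
  also have "\<dots> = inner_on J x ?g"
    using inner_orthogonal_part[OF on R] by simp
  also have "\<dots> = inner_on J x x - (\<Sum>s\<in>R. inner_on J x (\<psi> s) * inner_on J (\<psi> s) x)"
    by (simp add: orthogonal_part_def inner_on_diff_right inner_on_sum_right inner_on_mult_right)
  also have "(\<Sum>s\<in>R. inner_on J x (\<psi> s) * inner_on J (\<psi> s) x) =
      of_real (\<Sum>s\<in>R. (cmod (inner_on J (\<psi> s) x))\<^sup>2)"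
    using complex_norm_square[of "inner_on J (\<psi> _) x"]
    by (simp add: cnj_inner_on mult.commute)
  finally have "of_real (\<Sum>j\<in>J. (cmod (?g j))\<^sup>2) = (of_real
      ((\<Sum>j\<in>J. (cmod (x j))\<^sup>2) - (\<Sum>s\<in>R. (cmod (inner_on J (\<psi> s) x))\<^sup>2)) :: complex)"
    by (simp add: inner_on_self)
  then have "(\<Sum>j\<in>J. (cmod (?g j))\<^sup>2) =
      (\<Sum>j\<in>J. (cmod (x j))\<^sup>2) - (\<Sum>s\<in>R. (cmod (inner_on J (\<psi> s) x))\<^sup>2)"
    by (rule of_real_eq_iff[THEN iffD1])
  moreover have "0 \<le> (\<Sum>j\<in>J. (cmod (?g j))\<^sup>2)"
    by (simp add: sum_nonneg)
  ultimately show ?thesis by simp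
qed

text \<open>
  Only the common kernel of the functionals \<open>\<phi> r\<close> matters below, so the orthonormal system is
  required to cut out a subspace of that kernel rather than to have the same span. The system is
  indexed by a subset of \<open>R\<close>, which bounds its size by \<open>card R\<close> without a notion of dimension.
\<close>

lemma Gram_Schmidt:
  fixes \<phi> :: "'r \<Rightarrow> 'j \<Rightarrow> complex"
  assumes J: "finite J" and R: "finite R"
  shows "\<exists>R' \<psi>. R' \<subseteq> R \<and> orthonormal_on J R' \<psi> \<and>
    (\<forall>c. (\<forall>s\<in>R'. inner_on J (\<psi> s) c = 0) \<longrightarrow> (\<forall>r\<in>R. (\<Sum>j\<in>J. \<phi> r j * c j) = 0))"
  using R
proof induction
  case empty
  then show ?case by (simp add: orthonormal_on_def)
next
  case (insert r R)
  then obtain R' \<psi> where R': "R' \<subseteq> R" and on: "orthonormal_on J R' \<psi>"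
    and ker: "\<forall>c. (\<forall>s\<in>R'. inner_on J (\<psi> s) c = 0) \<longrightarrow> (\<forall>r\<in>R. (\<Sum>j\<in>J. \<phi> r j * c j) = 0)"
    by (elim exE conjE) (rule that)
  note ker = ker[rule_format]
  have fin: "finite R'" using R' insert finite_subset by blast
  have r: "r \<notin> R'" using R' insert by auto
  \<comment> \<open>The inner product is antilinear on the left, so conjugation turns the functional into the
    vector representing it.\<close>
  define f where "f = (\<lambda>j. cnj (\<phi> r j))"
  define g where "g = orthogonal_part J R' \<psi> f"
  have g\<psi>: "inner_on J (\<psi> s) g = 0" if "s \<in> R'" for s
    unfolding g_def using on fin that by (rule inner_orthogonal_part)
  have \<psi>g: "inner_on J g (\<psi> s) = 0" if "s \<in> R'" for s
    using g\<psi>[OF that] by (metis cnj_inner_on complex_cnj_zero)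
  \<comment> \<open>On vectors orthogonal to the previous system, replacing the new vector by its orthogonal part
    changes nothing.\<close>
  have \<phi>r: "(\<Sum>j\<in>J. \<phi> r j * c j) = inner_on J g c"
    if "\<And>s. s \<in> R' \<Longrightarrow> inner_on J (\<psi> s) c = 0" for c
  proof -
    have "inner_on J g c = inner_on J f c - (\<Sum>s\<in>R'. cnj (inner_on J (\<psi> s) f) * inner_on J (\<psi> s) c)"
      by (subst g_def, subst (1) orthogonal_part_def,
          simp add: inner_on_def algebra_simps sum_subtractf sum_distrib_left sum_distrib_right
            sum.swap[of _ R' J])
        (rule sum.cong[OF refl], rule sum.swap)
    then show ?thesis using that by (simp add: inner_on_def f_def)
  qed
  show ?case
  proof (cases "\<forall>j\<in>J. g j = 0")
    case True
    then have "inner_on J g c = 0" for c by (simp add: inner_on_def)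
    then have "\<forall>c. (\<forall>s\<in>R'. inner_on J (\<psi> s) c = 0) \<longrightarrow>
        (\<forall>r\<in>insert r R. (\<Sum>j\<in>J. \<phi> r j * c j) = 0)"
      using \<phi>r ker by (intro allI impI ballI) auto
    then show ?thesis
      using R' on by (intro exI[of _ R'] exI[of _ \<psi>] conjI) auto
  next
    case False
    define N where "N = sqrt (\<Sum>j\<in>J. (cmod (g j))\<^sup>2)"
    have "0 < (\<Sum>j\<in>J. (cmod (g j))\<^sup>2)"
      using False J by (auto intro: sum_pos2)
    then have N: "N > 0" "N\<^sup>2 = (\<Sum>j\<in>J. (cmod (g j))\<^sup>2)" by (simp_all add: N_def)
    define \<psi>' where "\<psi>' = \<psi>(r := (\<lambda>j. g j / of_real N))"
    have div: "inner_on J (\<lambda>j. g j / of_real N) c = inner_on J g c / of_real N"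
      "inner_on J c (\<lambda>j. g j / of_real N) = inner_on J c g / of_real N" for c
      by (simp_all add: inner_on_def sum_divide_distrib)
    have gg: "inner_on J g g = of_real N * of_real N"
      by (simp only: inner_on_self N(2)[symmetric] of_real_power) (simp only: power2_eq_square)
    have \<psi>'r: "\<psi>' r = (\<lambda>j. g j / of_real N)" by (simp add: \<psi>'_def)
    have \<psi>'s: "\<psi>' s = \<psi> s" if "s \<in> R'" for s using that r by (auto simp: \<psi>'_def)
    have "orthonormal_on J (insert r R') \<psi>'"
      unfolding orthonormal_on_def
      using on N r by (auto simp: \<psi>'r \<psi>'s div gg g\<psi> \<psi>g orthonormal_on_def)
    moreover have "(\<Sum>j\<in>J. \<phi> t j * c j) = 0"
      if "\<forall>s\<in>insert r R'. inner_on J (\<psi>' s) c = 0" and "t \<in> insert r R" for c t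
    proof -
      have *: "inner_on J (\<psi> s) c = 0" if "s \<in> R'" for s
        using that \<open>\<forall>s\<in>insert r R'. _\<close> \<psi>'s by fastforce
      have "inner_on J g c = 0"
        using that(1) N by (simp add: \<psi>'r div)
      then show ?thesis using \<phi>r[OF *] ker[OF *] that(2) by auto
    qed
    ultimately show ?thesis
      using R' by (intro exI[of _ "insert r R'"] exI[of _ \<psi>'] conjI allI impI ballI) auto
  qed
qed

text \<open>
  The inequality \<open>\<bar>tr A\<bar>\<^sup>2 \<le> rank A \<cdot> \<parallel>A\<parallel>\<^sup>2\<close> for the Hilbert--Schmidt norm, with the rank replaced by
  the number of linear conditions that force a vector into the kernel of \<open>A\<close>. If those conditions
  come from an orthonormal system \<open>\<psi>\<close>, then \<open>A\<close> equals \<open>\<Sum>\<^sub>s (A \<psi>\<^sub>s) \<psi>\<^sub>s\<^sup>*\<close>, so the trace is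
  \<open>\<Sum>\<^sub>s \<langle>\<psi>\<^sub>s, A \<psi>\<^sub>s\<rangle>\<close>; the Cauchy--Schwarz inequality bounds it, and Bessel's inequality, applied to
  every row of \<open>A\<close>, bounds \<open>\<Sum>\<^sub>s \<parallel>A \<psi>\<^sub>s\<parallel>\<^sup>2\<close>.

  A lower bound for a rank that follows from the entries alone is what makes it possible to count
  linearly independent vectors among the truncations of a square-summable function.
\<close>

lemma trace_le_rank_Hilbert_Schmidt:
  fixes A :: "'j \<Rightarrow> 'j \<Rightarrow> complex" and \<phi> :: "'r \<Rightarrow> 'j \<Rightarrow> complex"
  assumes J: "finite J" and R: "finite R"
    and ker: "\<And>c i. (\<And>r. r \<in> R \<Longrightarrow> (\<Sum>j\<in>J. \<phi> r j * c j) = 0) \<Longrightarrow> i \<in> J \<Longrightarrow> (\<Sum>j\<in>J. A i j * c j) = 0"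
  shows "(cmod (\<Sum>j\<in>J. A j j))\<^sup>2 \<le> real (card R) * (\<Sum>i\<in>J. \<Sum>j\<in>J. (cmod (A i j))\<^sup>2)"
proof -
  obtain R' \<psi> where R': "R' \<subseteq> R" and on: "orthonormal_on J R' \<psi>"
    and \<psi>: "\<forall>c. (\<forall>s\<in>R'. inner_on J (\<psi> s) c = 0) \<longrightarrow> (\<forall>r\<in>R. (\<Sum>j\<in>J. \<phi> r j * c j) = 0)"
    using Gram_Schmidt[OF J R, of \<phi>] by (elim exE conjE) (rule that)
  note \<psi> = \<psi>[rule_format]
  have fin: "finite R'" using R' R finite_subset by blast
  define B where "B s i = (\<Sum>j\<in>J. A i j * \<psi> s j)" for s i
  have entry: "A i j = (\<Sum>s\<in>R'. B s i * cnj (\<psi> s j))" if ij: "i \<in> J" "j \<in> J" for i j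
  proof -
    define e where "e k = (if k = j then 1 else 0 :: complex)" for k
    have e: "inner_on J (\<psi> s) e = cnj (\<psi> s j)" for s
      using ij J by (simp add: inner_on_def e_def if_distrib cong: if_cong)
    \<comment> \<open>The orthogonal part of a unit vector satisfies all conditions, so \<open>A\<close> kills it.\<close>
    have "(\<Sum>k\<in>J. A i k * orthogonal_part J R' \<psi> e k) = 0"
      by (rule ker[OF \<psi>]) (simp_all add: inner_orthogonal_part on fin ij)
    then have "(\<Sum>k\<in>J. A i k * e k) = (\<Sum>s\<in>R'. B s i * cnj (\<psi> s j))"
      unfolding orthogonal_part_def B_def e
      by (simp add: algebra_simps sum_subtractf sum_distrib_left sum_distrib_right
          sum.swap[of _ R' J])
    then show ?thesis using ij J by (simp add: e_def if_distrib cong: if_cong)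
  qed
  have "(\<Sum>j\<in>J. A j j) = (\<Sum>j\<in>J. \<Sum>s\<in>R'. B s j * cnj (\<psi> s j))"
    by (rule sum.cong) (simp_all flip: entry)
  also have "\<dots> = (\<Sum>(j, s)\<in>J \<times> R'. B s j * cnj (\<psi> s j))"
    by (simp add: sum.cartesian_product)
  finally have "cmod (\<Sum>j\<in>J. A j j) \<le> (\<Sum>(j, s)\<in>J \<times> R'. cmod (B s j) * cmod (\<psi> s j))"
    by (simp add: split_def) (rule order_trans[OF norm_sum], simp add: norm_mult)
  then have "(cmod (\<Sum>j\<in>J. A j j))\<^sup>2 \<le> (\<Sum>(j, s)\<in>J \<times> R'. cmod (B s j) * cmod (\<psi> s j))\<^sup>2"
    by (simp add: power_mono)
  also have "\<dots> \<le> (\<Sum>(j, s)\<in>J \<times> R'. (cmod (B s j))\<^sup>2) * (\<Sum>(j, s)\<in>J \<times> R'. (cmod (\<psi> s j))\<^sup>2)"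
    using Cauchy_Schwarz_ineq_sum[of "\<lambda>(j, s). cmod (B s j)" "\<lambda>(j, s). cmod (\<psi> s j)" "J \<times> R'"]
    by (simp add: split_def)
  also have "(\<Sum>(j, s)\<in>J \<times> R'. (cmod (\<psi> s j))\<^sup>2) = (\<Sum>s\<in>R'. \<Sum>j\<in>J. (cmod (\<psi> s j))\<^sup>2)"
    by (simp add: sum.cartesian_product[symmetric] sum.swap[of _ R' J])
  also have "\<dots> = real (card R')"
  proof -
    have "(\<Sum>j\<in>J. (cmod (\<psi> s j))\<^sup>2) = 1" if "s \<in> R'" for s
    proof -
      have "complex_of_real (\<Sum>j\<in>J. (cmod (\<psi> s j))\<^sup>2) = of_real 1"
        using on that inner_on_self[of J "\<psi> s"] by (simp add: orthonormal_on_def)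
      then show ?thesis by (rule of_real_eq_iff[THEN iffD1])
    qed
    then show ?thesis by simp
  qed
  also have "(\<Sum>(j, s)\<in>J \<times> R'. (cmod (B s j))\<^sup>2) \<le> (\<Sum>i\<in>J. \<Sum>j\<in>J. (cmod (A i j))\<^sup>2)"
  proof -
    have "(\<Sum>s\<in>R'. (cmod (B s i))\<^sup>2) \<le> (\<Sum>j\<in>J. (cmod (A i j))\<^sup>2)" for i
    proof -
      have "cmod (B s i) = cmod (inner_on J (\<psi> s) (\<lambda>j. cnj (A i j)))" for s
        by (subst complex_mod_cnj[symmetric], simp add: B_def inner_on_def mult.commute)
      then show ?thesis using Bessel_inequality[OF on fin, of "\<lambda>j. cnj (A i j)"] by simp
    qed
    then show ?thesis by (simp add: sum.cartesian_product[symmetric] sum_mono)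
  qed
  finally have "(cmod (\<Sum>j\<in>J. A j j))\<^sup>2 \<le> (\<Sum>i\<in>J. \<Sum>j\<in>J. (cmod (A i j))\<^sup>2) * real (card R')"
    by (simp add: mult_right_mono)
  also have "\<dots> \<le> (\<Sum>i\<in>J. \<Sum>j\<in>J. (cmod (A i j))\<^sup>2) * real (card R)"
    using R R' by (intro mult_left_mono sum_nonneg) (simp_all add: card_mono)
  finally show ?thesis by (simp add: mult.commute)
qed

text \<open>
  The case of the identity matrix: a homogeneous linear system with fewer equations than unknowns
  has a nonzero solution.
\<close>

corollary card_le_if_kernel_trivial:
  fixes \<phi> :: "'r \<Rightarrow> 'j \<Rightarrow> complex"
  assumes J: "finite J" and R: "finite R"
    and ker: "\<And>c j. (\<And>r. r \<in> R \<Longrightarrow> (\<Sum>j\<in>J. \<phi> r j * c j) = 0) \<Longrightarrow> j \<in> J \<Longrightarrow> c j = 0"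
  shows "card J \<le> card R"
proof -
  let ?I = "\<lambda>i j. if i = j then 1 else 0 :: complex"
  have unit: "(\<Sum>j\<in>J. ?I i j * c j) = c i" if "i \<in> J" for c i
  proof -
    have "(\<Sum>j\<in>J. ?I i j * c j) = (\<Sum>j\<in>J. if i = j then c j else 0)"
      by (intro sum.cong) auto
    then show ?thesis using that J by simp
  qed
  have "(cmod (\<Sum>j\<in>J. ?I j j))\<^sup>2 \<le> real (card R) * (\<Sum>i\<in>J. \<Sum>j\<in>J. (cmod (?I i j))\<^sup>2)"
  proof (rule trace_le_rank_Hilbert_Schmidt[OF J R])
    fix c i
    assume c: "\<And>r. r \<in> R \<Longrightarrow> (\<Sum>j\<in>J. \<phi> r j * c j) = 0" and i: "i \<in> J"
    show "(\<Sum>j\<in>J. ?I i j * c j) = 0"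
      unfolding unit[OF i] by (rule ker[OF c i])
  qed
  moreover have "(\<Sum>i\<in>J. \<Sum>j\<in>J. (cmod (?I i j))\<^sup>2) = real (card J)"
  proof -
    have "(\<Sum>j\<in>J. (cmod (?I i j))\<^sup>2) = (\<Sum>j\<in>J. if i = j then 1 else 0)" for i
      by (intro sum.cong) auto
    then show ?thesis using J by simp
  qed
  ultimately have "(real (card J))\<^sup>2 \<le> real (card R) * real (card J)"
    by simp
  then have "card J * card J \<le> card R * card J"
    unfolding power2_eq_square of_nat_mult[symmetric] of_nat_le_iff .
  then show ?thesis
    by (simp only: mult_le_cancel2) linarith
qed

section \<open>Boxes in the lattice\<close>

definition lattice_box :: "int \<Rightarrow> int \<Rightarrow> (int ^ 'd) set" where
  "lattice_box l u = {n. \<forall>i. l \<le> n $ i \<and> n $ i < u}"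

lemma bij_betw_lattice_box:
  "bij_betw (\<lambda>f. \<chi> i. f i) (Pi\<^sub>E UNIV (\<lambda>_. {l..<u})) (lattice_box l u :: (int ^ 'd) set)"
proof (rule bij_betwI[where g = "($)"])
  show "(\<lambda>f. \<chi> i. f i) \<in> Pi\<^sub>E UNIV (\<lambda>_. {l..<u}) \<rightarrow> (lattice_box l u :: (int ^ 'd) set)"
    by (force simp: lattice_box_def PiE_iff)
  show "($) \<in> (lattice_box l u :: (int ^ 'd) set) \<rightarrow> Pi\<^sub>E UNIV (\<lambda>_. {l..<u})"
    by (force simp: lattice_box_def PiE_iff)
qed (simp_all add: fun_eq_iff)

lemma finite_lattice_box [simp]: "finite (lattice_box l u)"
  using bij_betw_finite[OF bij_betw_lattice_box] by (simp add: finite_PiE)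

lemma sum_lattice_box_prod:
  fixes g :: "'d::finite \<Rightarrow> int \<Rightarrow> 'a::comm_semiring_1"
  shows "(\<Sum>n\<in>lattice_box l u. \<Prod>i\<in>UNIV. g i (n $ i)) = (\<Prod>i\<in>UNIV. \<Sum>k\<in>{l..<u}. g i k)"
proof -
  have "(\<Prod>i\<in>UNIV. \<Sum>k\<in>{l..<u}. g i k) = (\<Sum>f\<in>Pi\<^sub>E UNIV (\<lambda>_. {l..<u}). \<Prod>i\<in>UNIV. g i (f i))"
    by (rule prod_sum_PiE) simp_all
  also have "\<dots> = (\<Sum>n\<in>lattice_box l u. \<Prod>i\<in>UNIV. g i (n $ i))"
    using sum.reindex_bij_betw[OF bij_betw_lattice_box, of "\<lambda>n. \<Prod>i\<in>UNIV. g i (n $ i)" l u]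
    by simp
  finally show ?thesis ..
qed

lemma card_lattice_box: "card (lattice_box l u :: (int ^ 'd) set) = nat (u - l) ^ CARD('d)"
  using sum_lattice_box_prod[of "\<lambda>_ _. 1 :: nat" l u] by simp

lemma bounded_lattice_set:
  fixes S :: "(int ^ 'd) set"
  assumes "finite S"
  obtains s :: nat where "\<And>m i. m \<in> S \<Longrightarrow> \<bar>m $ i\<bar> \<le> int s"
proof
  fix m i assume "m \<in> S"
  then have "nat \<bar>m $ i\<bar> \<in> (\<lambda>(m, i). nat \<bar>m $ i\<bar>) ` (S \<times> UNIV)"
    by force
  then have "nat \<bar>m $ i\<bar> \<le> Max ((\<lambda>(m, i). nat \<bar>m $ i\<bar>) ` (S \<times> UNIV))"
    using assms by (intro Max_ge) auto
  then show "\<bar>m $ i\<bar> \<le> int (Max ((\<lambda>(m, i). nat \<bar>m $ i\<bar>) ` (S \<times> UNIV)))"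
    by linarith
qed

text \<open>
  At a position outside this set, an operator with shifts in \<open>S\<close> reads values only from inside the box
  of side \<open>L\<close> or only from outside it.
\<close>

definition box_boundary :: "(int ^ 'd) set \<Rightarrow> nat \<Rightarrow> (int ^ 'd) set" where
  "box_boundary S L =
     {n. (\<exists>m\<in>S. n + m \<in> lattice_box 0 (int L)) \<and> (\<exists>m\<in>S. n + m \<notin> lattice_box 0 (int L))}"

lemma box_boundary_subset:
  assumes "\<And>m i. m \<in> S \<Longrightarrow> \<bar>m $ i\<bar> \<le> int s"
  shows "box_boundary S L \<subseteq>
    lattice_box (- int s) (int L + int s) - lattice_box (int s) (int L - int s)"
proof
  fix n assume "n \<in> box_boundary S L"
  then obtain m m' where m: "m \<in> S" "n + m \<in> lattice_box 0 (int L)"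
    and m': "m' \<in> S" "n + m' \<notin> lattice_box 0 (int L)"
    unfolding box_boundary_def by blast
  have "- int s \<le> n $ i \<and> n $ i < int L + int s" for i
    using m(2) assms[OF m(1), of i] unfolding lattice_box_def
    by (auto dest!: spec[of _ i])
  moreover obtain i where "\<not> (0 \<le> n $ i + m' $ i \<and> n $ i + m' $ i < int L)"
    using m'(2) unfolding lattice_box_def by auto
  then have "\<not> (int s \<le> n $ i \<and> n $ i < int L - int s)"
    using assms[OF m'(1), of i] by linarith
  ultimately show "n \<in> lattice_box (- int s) (int L + int s) - lattice_box (int s) (int L - int s)"
    unfolding lattice_box_def by blast
qed

lemma finite_box_boundary [simp]:
  assumes "finite S"
  shows "finite (box_boundary S L)"
proof -
  obtain s where "\<And>m i. m \<in> S \<Longrightarrow> \<bar>m $ i\<bar> \<le> int s"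
    using bounded_lattice_set[OF assms] by blast
  then show ?thesis
    by (rule finite_subset[OF box_boundary_subset]) simp_all
qed

text \<open>
  The boundary lies between two concentric boxes whose sides differ from \<open>L\<close> by a bounded amount,
  so its share of the volume \<open>L\<^sup>d\<close> tends to zero. This is the amenability of \<open>\<int>\<^sup>d\<close>, and every
  limit argument below rests on it.
\<close>

lemma box_boundary_density:
  fixes S :: "(int ^ 'd) set"
  assumes "finite S"
  shows "(\<lambda>L. real (card (box_boundary S L)) / real L ^ CARD('d)) \<longlonglongrightarrow> 0"
proof -
  obtain s where s: "\<And>m i. m \<in> S \<Longrightarrow> \<bar>m $ i\<bar> \<le> int s"
    using bounded_lattice_set[OF assms] by blast
  let ?B = "\<lambda>L. lattice_box (- int s) (int L + int s) :: (int ^ 'd) set"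
  let ?C = "\<lambda>L. lattice_box (int s) (int L - int s) :: (int ^ 'd) set"
  have CB: "?C L \<subseteq> ?B L" for L
    unfolding lattice_box_def by (rule Collect_mono) (smt (verit) of_nat_0_le_iff)
  have bound: "real (card (box_boundary S L)) / real L ^ CARD('d) \<le>
      (1 + 2 * real s / real L) ^ CARD('d) - (1 - 2 * real s / real L) ^ CARD('d)"
    if L: "L > 2 * s" for L
  proof -
    have "card (box_boundary S L) \<le> card (?B L - ?C L)"
      using box_boundary_subset[OF s] by (intro card_mono) auto
    also have "\<dots> = card (?B L) - card (?C L)"
      by (intro card_Diff_subset CB finite_lattice_box)
    finally have le: "card (box_boundary S L) \<le> card (?B L) - card (?C L)" .
    have "card (?C L) \<le> card (?B L)"
      by (intro card_mono CB finite_lattice_box)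
    with le have "real (card (box_boundary S L)) \<le> real (card (?B L)) - real (card (?C L))"
      by linarith
    also have "real (card (?B L)) = (real L + 2 * real s) ^ CARD('d)"
    proof -
      have "nat (int L + int s + int s) = L + 2 * s" by linarith
      then show ?thesis by (simp add: card_lattice_box)
    qed
    also have "real (card (?C L)) = (real L - 2 * real s) ^ CARD('d)"
    proof -
      have "nat (int L - int s - int s) = L - 2 * s" by linarith
      then show ?thesis using L by (simp add: card_lattice_box of_nat_diff)
    qed
    finally have "real (card (box_boundary S L)) / real L ^ CARD('d) \<le>
        ((real L + 2 * real s) ^ CARD('d) - (real L - 2 * real s) ^ CARD('d)) / real L ^ CARD('d)"
      by (rule divide_right_mono) simp
    also have "\<dots> = ((real L + 2 * real s) / real L) ^ CARD('d) - ((real L - 2 * real s) / real L) ^ CARD('d)"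
      by (simp only: diff_divide_distrib[of "_ ^ _"] power_divide)
    also have "(real L + 2 * real s) / real L = 1 + 2 * real s / real L"
      using L by (simp add: field_simps)
    also have "(real L - 2 * real s) / real L = 1 - 2 * real s / real L"
      using L by (simp add: field_simps)
    finally show ?thesis .
  qed
  have s0: "(\<lambda>L. 2 * real s / real L) \<longlonglongrightarrow> 0"
    by (rule lim_const_over_n)
  have "(\<lambda>L. (1 + 2 * real s / real L) ^ CARD('d) - (1 - 2 * real s / real L) ^ CARD('d))
      \<longlonglongrightarrow> (1 + 0) ^ CARD('d) - (1 - 0) ^ CARD('d)"
    by (intro tendsto_intros s0)
  then have upper: "(\<lambda>L. (1 + 2 * real s / real L) ^ CARD('d) - (1 - 2 * real s / real L) ^ CARD('d))
      \<longlonglongrightarrow> 0"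
    by simp
  show ?thesis
    by (rule tendsto_sandwich[OF _ _ tendsto_const upper])
      (auto intro!: always_eventually eventually_sequentiallyI[of "2 * s + 1"] bound)
qed

section \<open>Translation-invariant operators of finite range\<close>

text \<open>
  Flexes and stresses of a crystal framework are both kernels of translation-invariant operators
  between spaces of functions on finitely many copies of the lattice, one being the transpose of the
  other. The index sets \<open>P\<close> and \<open>Q\<close> number the copies in the domain and in the codomain. Isolating
  such operators allows every analytic argument to be given once and used for both.
\<close>

locale finite_range_operator =
  fixes P :: "'p set" and Q :: "'q set" and S :: "(int ^ 'd) set"
    and K :: "'q \<Rightarrow> 'p \<Rightarrow> int ^ 'd \<Rightarrow> complex"
  assumes finite_P: "finite P" and finite_Q: "finite Q" and finite_S: "finite S"
begin

definition conv :: "('p \<Rightarrow> int ^ 'd \<Rightarrow> complex) \<Rightarrow> 'q \<Rightarrow> int ^ 'd \<Rightarrow> complex" where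
  "conv x q n = (\<Sum>p\<in>P. \<Sum>m\<in>S. K q p m * x p (n + m))"

definition symbol :: "complex ^ 'd \<Rightarrow> 'q \<Rightarrow> 'p \<Rightarrow> complex" where
  "symbol z q p = (\<Sum>m\<in>S. K q p m * monomial z m)"

lemma conv_sum: "conv (\<lambda>p n. \<Sum>j\<in>J. f j p n * c j) q n = (\<Sum>j\<in>J. conv (f j) q n * c j)"
  unfolding conv_def
  by (simp add: sum_distrib_left sum_distrib_right mult.assoc sum.swap[of _ J])

definition truncate :: "nat \<Rightarrow> ('p \<Rightarrow> int ^ 'd \<Rightarrow> complex) \<Rightarrow> 'p \<Rightarrow> int ^ 'd \<Rightarrow> complex" where
  "truncate L x p n = (if n \<in> lattice_box 0 (int L) then x p n else 0)"

text \<open>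
  Away from the boundary the operator sees either the whole function, which it kills, or nothing.
\<close>

lemma conv_truncate:
  assumes "conv x q n = 0" "n \<notin> box_boundary S L"
  shows "conv (truncate L x) q n = 0"
proof -
  consider "\<forall>m\<in>S. n + m \<in> lattice_box 0 (int L)" | "\<forall>m\<in>S. n + m \<notin> lattice_box 0 (int L)"
    using assms(2) unfolding box_boundary_def by blast
  then show ?thesis
  proof cases
    case 1
    then have "conv (truncate L x) q n = conv x q n"
      unfolding conv_def truncate_def by (intro sum.cong refl) simp
    then show ?thesis using assms(1) by simp
  next
    case 2
    then show ?thesis
      unfolding conv_def truncate_def by (intro sum.neutral ballI) simp
  qed
qed

end

text \<open>
  For the rigidity operator and its transpose, the assumption says that there are no internal flexes
  and no internal stresses.
\<close>

locale finitely_injective_operator = finite_range_operator P Q S K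
  for P :: "'p set" and Q :: "'q set" and S :: "(int ^ 'd) set" and K +
  assumes finite_kernel_trivial:
    "\<And>x p n. (\<And>p. p \<in> P \<Longrightarrow> finite {n. x p n \<noteq> 0}) \<Longrightarrow>
      (\<And>q n. q \<in> Q \<Longrightarrow> conv x q n = 0) \<Longrightarrow> p \<in> P \<Longrightarrow> x p n = 0"
begin

text \<open>
  Truncating a kernel element to a box costs only the values on the boundary of the box. If these
  cancel in a linear combination, the truncated combination is a finitely supported kernel element
  and therefore zero. Hence kernel elements restricted to a box of side \<open>L\<close> are governed by
  \<open>card Q\<close> times the number of boundary positions, which is \<open>o(L\<^sup>d)\<close>, many linear conditions.
\<close>

lemma vanishing_boundary_values:
  fixes u :: "'j \<Rightarrow> 'p \<Rightarrow> int ^ 'd \<Rightarrow> complex"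
  assumes u: "\<And>j q n. j \<in> J \<Longrightarrow> q \<in> Q \<Longrightarrow> conv (u j) q n = 0"
    and c: "\<And>r. r \<in> Q \<times> box_boundary S L \<Longrightarrow> (\<Sum>j\<in>J. conv (truncate L (u j)) (fst r) (snd r) * c j) = 0"
    and p: "p \<in> P" and n: "n \<in> lattice_box 0 (int L)"
  shows "(\<Sum>j\<in>J. u j p n * c j) = 0"
proof -
  define w where "w = (\<lambda>p n. \<Sum>j\<in>J. truncate L (u j) p n * c j)"
  have "w p n = 0"
  proof (rule finite_kernel_trivial[OF _ _ p])
    show "finite {n. w p n \<noteq> 0}" for p
      by (rule finite_subset[of _ "lattice_box 0 (int L)"]) (auto simp: w_def truncate_def intro: ccontr)
    show "conv w q n = 0" if q: "q \<in> Q" for q n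
    proof (cases "n \<in> box_boundary S L")
      case True
      then show ?thesis using c[of "(q, n)"] q by (simp add: w_def conv_sum)
    next
      case False
      then show ?thesis using u q by (simp add: w_def conv_sum conv_truncate)
    qed
  qed
  then show ?thesis
    using n by (simp add: w_def truncate_def)
qed

text \<open>
  Suppose that \<open>x p n0\<close> is nonzero and consider the \<open>L\<^sup>d\<close> translates of \<open>x\<close> by the vectors of a
  box, restricted to that box. Arranged as a matrix (position against translation), the component
  \<open>p\<close> of these functions has the constant \<open>x p n0\<close> on the diagonal, hence trace of order \<open>L\<^sup>d\<close>,
  while its squared Hilbert--Schmidt norm is at most \<open>L\<^sup>d \<parallel>x\<parallel>\<^sup>2\<close>. The trace inequality would then
  require a number of conditions of order \<open>L\<^sup>d\<close>, but only \<open>o(L\<^sup>d)\<close> are available.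
\<close>

theorem square_summable_kernel_trivial:
  assumes ker: "\<And>q n. q \<in> Q \<Longrightarrow> conv x q n = 0"
    and sq: "\<And>p. p \<in> P \<Longrightarrow> (\<lambda>n. (cmod (x p n))\<^sup>2) summable_on UNIV"
    and p: "p \<in> P"
  shows "x p n0 = 0"
proof -
  define M where "M = (\<Sum>\<^sub>\<infinity>n. (cmod (x p n))\<^sup>2)"
  let ?d = "CARD('d)"
  have bound: "(cmod (x p n0))\<^sup>2 \<le> real (card Q) * M * (real (card (box_boundary S L)) / real L ^ ?d)"
    if L: "L > 0" for L
  proof -
    let ?J = "lattice_box 0 (int L) :: (int ^ 'd) set"
    \<comment> \<open>The shift by \<open>n0\<close> moves the value under consideration to the diagonal.\<close>
    define u where "u j p n = x p (n - j + n0)" for j p n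
    have "conv (u j) q n = conv x q (n - j + n0)" for j q n
      by (simp add: conv_def u_def algebra_simps)
    then have u: "conv (u j) q n = 0" if "q \<in> Q" for j q n
      using ker that by simp
    have "(cmod (\<Sum>j\<in>?J. u j p j))\<^sup>2 \<le>
        real (card (Q \<times> box_boundary S L)) * (\<Sum>i\<in>?J. \<Sum>j\<in>?J. (cmod (u j p i))\<^sup>2)"
    proof (rule trace_le_rank_Hilbert_Schmidt)
      show "finite (Q \<times> box_boundary S L)"
        by (simp add: finite_Q finite_S)
      show "(\<Sum>j\<in>?J. u j p i * c j) = 0"
        if "\<And>r. r \<in> Q \<times> box_boundary S L \<Longrightarrow>
            (\<Sum>j\<in>?J. conv (truncate L (u j)) (fst r) (snd r) * c j) = 0" and "i \<in> ?J" for c i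
        using vanishing_boundary_values[of ?J u L c p i] u that p by blast
    qed simp
    also have "(\<Sum>i\<in>?J. \<Sum>j\<in>?J. (cmod (u j p i))\<^sup>2) \<le> (\<Sum>i\<in>?J. M)"
    proof (rule sum_mono)
      fix i :: "int ^ 'd"
      have "(\<Sum>j\<in>?J. (cmod (u j p i))\<^sup>2) = (\<Sum>n\<in>(\<lambda>j. i - j + n0) ` ?J. (cmod (x p n))\<^sup>2)"
        by (subst sum.reindex) (auto simp: inj_on_def u_def)
      also have "\<dots> \<le> M"
        unfolding M_def by (rule finite_sum_le_infsum[OF sq[OF p]]) auto
      finally show "(\<Sum>j\<in>?J. (cmod (u j p i))\<^sup>2) \<le> M" .
    qed
    finally have "(real L ^ ?d * cmod (x p n0))\<^sup>2 \<le>
        real (card Q * card (box_boundary S L)) * (real L ^ ?d * M)"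
      by (simp add: card_cartesian_product u_def card_lattice_box norm_mult norm_power mult_left_mono)
    then show ?thesis
      using L by (simp add: power2_eq_square field_simps)
  qed
  have "(\<lambda>L. real (card Q) * M * (real (card (box_boundary S L)) / real L ^ ?d)) \<longlonglongrightarrow> real (card Q) * M * 0"
    by (intro tendsto_intros box_boundary_density finite_S)
  then have "(cmod (x p n0))\<^sup>2 \<le> real (card Q) * M * 0"
    by (rule LIMSEQ_le_const) (use bound in \<open>auto intro!: exI[of _ 1]\<close>)
  then show ?thesis by simp
qed

end

section \<open>Characters on a periodic grid of the torus\<close>

definition torus_point :: "real ^ 'd \<Rightarrow> complex ^ 'd" where
  "torus_point t = (\<chi> i. cis (t $ i))"

definition grid_step :: "nat \<Rightarrow> int ^ 'd \<Rightarrow> real ^ 'd" where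
  "grid_step L k = (\<chi> i. 2 * pi * of_int (k $ i) / real L)"

lemma monomial_torus_point: "monomial (torus_point t) n = (\<Prod>i\<in>UNIV. cis (of_int (n $ i) * t $ i))"
  by (simp add: monomial_def torus_point_def cis_power_int)

lemma monomial_torus_point_add:
  "monomial (torus_point t) (m + n) = monomial (torus_point t) m * monomial (torus_point t) n"
  by (simp add: monomial_torus_point prod.distrib[symmetric] cis_mult distrib_right)

lemma sum_cis_root_of_unity:
  fixes r :: int
  assumes "\<bar>r\<bar> < int L"
  shows "(\<Sum>m\<in>{0..<int L}. cis (of_int m * (2 * pi * of_int r / real L))) =
    (if r = 0 then of_nat L else 0)"
proof (cases "r = 0")
  case False
  define w where "w = cis (2 * pi * of_int r / real L)"
  have L: "L > 0" using assms by linarith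
  have "w \<noteq> 1"
  proof
    assume "w = 1"
    then have "cos (2 * pi * of_int r / real L) = 1"
      by (metis cis.sel(1) one_complex.sel(1) w_def)
    then obtain k :: int where "2 * pi * of_int r / real L = of_int k * 2 * pi"
      unfolding cos_one_2pi_int by blast
    then have "real_of_int r = real_of_int (k * int L)"
      using L by (simp add: field_simps)
    then have "r = k * int L" by (rule of_int_eq_iff[THEN iffD1])
    then have "int L dvd r" by simp
    then show False using assms False zdvd_imp_le[of "int L" "\<bar>r\<bar>"] by simp
  qed
  have "w ^ L = cis (2 * pi * of_int r)"
    using L by (simp add: w_def Complex.DeMoivre)
  then have wL: "w ^ L = 1"
    by (simp add: cis_multiple_2pi)
  have "(\<Sum>m\<in>{0..<int L}. cis (of_int m * (2 * pi * of_int r / real L))) = (\<Sum>m\<in>int ` {0..<L}. w powi m)"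
    by (simp add: image_int_atLeastLessThan w_def cis_power_int)
  also have "\<dots> = (\<Sum>m<L. w ^ m)"
    by (subst sum.reindex) (auto simp: atLeast0LessThan intro: inj_onI)
  also have "\<dots> = 0"
    using \<open>w \<noteq> 1\<close> wL by (simp add: sum_gp_strict)
  finally show ?thesis using False by simp
qed simp

lemma grid_characters_orthogonal:
  fixes t :: "real ^ 'd"
  assumes "j \<in> lattice_box 0 (int L)" "k \<in> lattice_box 0 (int L)"
  shows "(\<Sum>n\<in>lattice_box 0 (int L). cnj (monomial (torus_point (t + grid_step L j)) n) *
      monomial (torus_point (t + grid_step L k)) n) = (if j = k then of_nat L ^ CARD('d) else 0)"
proof -
  have summand: "cnj (monomial (torus_point (t + grid_step L j)) n) *
        monomial (torus_point (t + grid_step L k)) n =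
      (\<Prod>i\<in>UNIV. cis (of_int (n $ i) * (2 * pi * of_int (k $ i - j $ i) / real L)))" for n :: "int ^ 'd"
    by (simp add: monomial_torus_point prod.distrib[symmetric] cis_cnj cis_mult grid_step_def
        field_simps diff_divide_distrib)
  have "(\<Sum>n\<in>lattice_box 0 (int L). cnj (monomial (torus_point (t + grid_step L j)) n) *
      monomial (torus_point (t + grid_step L k)) n) =
    (\<Prod>i\<in>UNIV. \<Sum>m\<in>{0..<int L}. cis (of_int m * (2 * pi * of_int (k $ i - j $ i) / real L)))"
    unfolding summand by (rule sum_lattice_box_prod)
  also have "\<dots> = (\<Prod>i\<in>UNIV. if k $ i - j $ i = 0 then of_nat L else 0)"
  proof (rule prod.cong[OF refl])
    fix i
    have "\<bar>k $ i - j $ i\<bar> < int L"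
      using assms unfolding lattice_box_def by (auto dest!: spec[of _ i])
    then show "(\<Sum>m\<in>{0..<int L}. cis (of_int m * (2 * pi * of_int (k $ i - j $ i) / real L))) =
        (if k $ i - j $ i = 0 then of_nat L else 0)"
      by (rule sum_cis_root_of_unity)
  qed
  also have "\<dots> = (if j = k then of_nat L ^ CARD('d) else 0)"
  proof (cases "j = k")
    case False
    then obtain i where "j $ i \<noteq> k $ i"
      by (auto simp: Finite_Cartesian_Product.vec_eq_iff)
    then have "\<exists>i\<in>UNIV. (if k $ i - j $ i = 0 then of_nat L else 0) = (0 :: complex)"
      by (intro bexI[of _ i]) auto
    then have "(\<Prod>i\<in>UNIV. if k $ i - j $ i = 0 then of_nat L else 0) = (0 :: complex)"
      by (intro prod_zero) auto
    then show ?thesis using False by simp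
  qed simp
  finally show ?thesis .
qed

section \<open>Averaging over translated grids\<close>

lemma emeasure_lborel_cube:
  fixes r :: real
  assumes "0 \<le> r"
  shows "emeasure lborel (cbox 0 (\<chi> i. r) :: (real ^ 'd) set) = ennreal (r ^ CARD('d))"
proof -
  have "measure lborel (cbox 0 (\<chi> i. r) :: (real ^ 'd) set) = r ^ CARD('d)"
    using assms by (subst content_cbox_cart) (auto simp: interval_eq_empty_cart not_less)
  then show ?thesis
    using emeasure_compact_finite[OF compact_cbox, of 0 "\<chi> i. r"]
    by (subst emeasure_eq_ennreal_measure) (auto simp: less_top)
qed

lemma cube_subset_translates:
  assumes L: "0 < L"
  shows "cbox 0 (\<chi> i. 2 * pi) \<subseteq>
    (\<Union>k\<in>lattice_box 0 (int L). (\<lambda>t. t + grid_step L k) ` cbox 0 (\<chi> i. 2 * pi / real L))"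
proof
  fix x :: "real ^ 'd" assume x: "x \<in> cbox 0 (\<chi> i. 2 * pi)"
  define h where "h = 2 * pi / real L"
  have h: "h > 0" using L by (simp add: h_def)
  have hL: "h * real L = 2 * pi" using L by (simp add: h_def)
  \<comment> \<open>The minimum takes care of the far faces of the cube, where the floor is \<open>L\<close>.\<close>
  define k where "k = (\<chi> i. min (int L - 1) \<lfloor>x $ i / h\<rfloor>)"
  have xi: "0 \<le> x $ i" "x $ i \<le> 2 * pi" for i
    using x by (auto simp: mem_box_cart)
  have k: "0 \<le> k $ i" "k $ i < int L" "h * k $ i \<le> x $ i" "x $ i \<le> h * k $ i + h" for i
  proof -
    have f: "0 \<le> \<lfloor>x $ i / h\<rfloor>" using xi h by simp
    show "0 \<le> k $ i" "k $ i < int L" using f L by (auto simp: k_def)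
    have "real_of_int (k $ i) \<le> x $ i / h"
      by (simp add: k_def) linarith
    then show "h * k $ i \<le> x $ i" using h by (simp add: field_simps)
    show "x $ i \<le> h * k $ i + h"
    proof (cases "\<lfloor>x $ i / h\<rfloor> < int L")
      case True
      then have "k $ i = \<lfloor>x $ i / h\<rfloor>" by (simp add: k_def)
      then have "x $ i / h \<le> k $ i + 1" by linarith
      then show ?thesis using h by (simp add: field_simps)
    next
      case False
      then have "k $ i = int L - 1" by (simp add: k_def)
      then have "real L = real_of_int (k $ i) + 1" by simp
      then have "h * k $ i + h = h * real L" by (simp only: distrib_left mult_1_right)
      then show ?thesis using xi hL by simp
    qed
  qed
  have step: "grid_step L k $ i = h * k $ i" for i
    by (simp add: grid_step_def h_def)
  have "x - grid_step L k \<in> cbox 0 (\<chi> i. 2 * pi / real L)"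
    using k by (auto simp: mem_box_cart step simp flip: h_def) (smt (verit))
  moreover have "k \<in> lattice_box 0 (int L)"
    using k by (simp add: lattice_box_def)
  ultimately show "x \<in> (\<Union>k\<in>lattice_box 0 (int L). (\<lambda>t. t + grid_step L k) ` cbox 0 (\<chi> i. 2 * pi / real L))"
    by (intro UN_I[of k]) (auto intro!: image_eqI[of _ _ "x - grid_step L k"])
qed

text \<open>
  Integrating the number of the \<open>L\<^sup>d\<close> points \<open>t + (2\<pi>/L) k\<close> that lie in \<open>A\<close>, over \<open>t\<close> in a small
  cube, recovers at least the measure of \<open>A\<close> in the large cube. A uniform bound on the count
  is therefore a bound on the measure.
\<close>

lemma emeasure_le_grid_count:
  fixes A :: "(real ^ 'd) set"
  assumes A: "A \<in> sets borel" and L: "0 < L"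
    and count: "\<And>t. card {k \<in> lattice_box 0 (int L). t + grid_step L k \<in> A} \<le> N"
  shows "emeasure lborel (A \<inter> cbox 0 (\<chi> i. 2 * pi)) \<le>
    ennreal ((2 * pi) ^ CARD('d) * (real N / real L ^ CARD('d)))"
proof -
  let ?J = "lattice_box 0 (int L) :: (int ^ 'd) set"
  define C where "C = (cbox 0 (\<chi> i. 2 * pi / real L) :: (real ^ 'd) set)"
  define B where "B k = {x. x \<in> A \<and> x - grid_step L k \<in> C}" for k
  have C: "C \<in> sets borel" by (simp add: C_def)
  note [measurable] = A C
  have [measurable]: "B k \<in> sets borel" for k
    unfolding B_def by measurable
  have translate: "emeasure lborel (B k) =
      (\<integral>\<^sup>+t. indicator {t. t + grid_step L k \<in> A} t * indicator C t \<partial>lborel)" for k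
  proof -
    have "emeasure lborel (B k) = (\<integral>\<^sup>+x. indicator (B k) x \<partial>lborel)"
      by simp
    also have "\<dots> = (\<integral>\<^sup>+x. indicator (B k) x \<partial>distr lborel borel ((+) (grid_step L k)))"
      by (simp add: lborel_distr_plus)
    also have "\<dots> = (\<integral>\<^sup>+t. indicator (B k) (grid_step L k + t) \<partial>lborel)"
      by (subst nn_integral_distr) auto
    also have "\<dots> = (\<integral>\<^sup>+t. indicator {t. t + grid_step L k \<in> A} t * indicator C t \<partial>lborel)"
      by (intro nn_integral_cong) (auto simp: B_def indicator_def add.commute)
    finally show ?thesis .
  qed
  have "cbox 0 (\<chi> i. 2 * pi) \<subseteq> (\<Union>k\<in>?J. (\<lambda>t. t + grid_step L k) ` C)"
    unfolding C_def by (rule cube_subset_translates[OF L])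
  then have "A \<inter> cbox 0 (\<chi> i. 2 * pi) \<subseteq> A \<inter> (\<Union>k\<in>?J. (\<lambda>t. t + grid_step L k) ` C)"
    by blast
  also have "\<dots> \<subseteq> (\<Union>k\<in>?J. B k)"
    by (auto simp: B_def)
  finally have "A \<inter> cbox 0 (\<chi> i. 2 * pi) \<subseteq> (\<Union>k\<in>?J. B k)" .
  then have "emeasure lborel (A \<inter> cbox 0 (\<chi> i. 2 * pi)) \<le> emeasure lborel (\<Union>k\<in>?J. B k)"
    by (intro emeasure_mono) auto
  also have "\<dots> \<le> (\<Sum>k\<in>?J. emeasure lborel (B k))"
    by (intro emeasure_subadditive_finite) auto
  also have "\<dots> = (\<integral>\<^sup>+t. (\<Sum>k\<in>?J. indicator {t. t + grid_step L k \<in> A} t * indicator C t) \<partial>lborel)"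
    unfolding translate by (intro nn_integral_sum[symmetric]) measurable
  also have "\<dots> \<le> (\<integral>\<^sup>+t. of_nat N * indicator C t \<partial>lborel)"
  proof (rule nn_integral_mono)
    fix t
    have "(\<Sum>k\<in>?J. indicator {t. t + grid_step L k \<in> A} t) =
        (of_nat (card {k \<in> ?J. t + grid_step L k \<in> A}) :: ennreal)"
      by (simp add: indicator_def sum.If_cases Int_def)
    also have "\<dots> \<le> of_nat N" using count[of t] by simp
    finally show "(\<Sum>k\<in>?J. indicator {t. t + grid_step L k \<in> A} t * indicator C t)
        \<le> (of_nat N * indicator C t :: ennreal)"
      by (simp add: sum_distrib_right[symmetric] mult_right_mono)
  qed
  also have "\<dots> = of_nat N * emeasure lborel C"
    by (simp add: nn_integral_cmult)
  also have "\<dots> = ennreal (real N) * ennreal ((2 * pi / real L) ^ CARD('d))"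
    unfolding C_def by (subst emeasure_lborel_cube) (simp_all add: ennreal_of_nat_eq_real_of_nat)
  also have "\<dots> = ennreal ((2 * pi) ^ CARD('d) * (real N / real L ^ CARD('d)))"
    by (subst ennreal_mult[symmetric]) (simp_all add: power_divide mult.commute)
  finally show ?thesis .
qed

context finite_range_operator begin

text \<open>
  An operator of finite range acts on plane waves through its symbol.
\<close>

lemma conv_wave:
  "conv (\<lambda>p n. monomial (torus_point t) n * c p) q n =
    monomial (torus_point t) n * (\<Sum>p\<in>P. symbol (torus_point t) q p * c p)"
  unfolding conv_def symbol_def
  by (simp add: monomial_torus_point_add sum_distrib_left sum_distrib_right algebra_simps)

end

context finitely_injective_operator begin

text \<open>
  By \<open>conv_wave\<close>, the angles at which the operator kills some nonzero plane wave.
\<close>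

definition singular_angles :: "(real ^ 'd) set" where
  "singular_angles = {t. \<exists>c. (\<exists>p\<in>P. c p \<noteq> 0) \<and>
     (\<forall>q\<in>Q. (\<Sum>p\<in>P. symbol (torus_point t) q p * c p) = 0)}"

text \<open>
  Each singular grid point carries a plane wave in the kernel of the operator. Waves at different
  points of the grid are orthogonal on the box of side \<open>L\<close>, so the waves are linearly
  independent there, and their number cannot exceed the number of boundary conditions.
\<close>

lemma card_singular_grid_points:
  assumes L: "0 < L"
  shows "card {k \<in> lattice_box 0 (int L). t + grid_step L k \<in> singular_angles}
    \<le> card Q * card (box_boundary S L)"
proof -
  let ?J = "{k \<in> lattice_box 0 (int L). t + grid_step L k \<in> singular_angles}"
  let ?z = "\<lambda>k. torus_point (t + grid_step L k)"
  have fin: "finite ?J" by simp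
  have "\<forall>k\<in>?J. \<exists>c. (\<exists>p\<in>P. c p \<noteq> 0) \<and> (\<forall>q\<in>Q. (\<Sum>p\<in>P. symbol (?z k) q p * c p) = 0)"
    by (simp add: singular_angles_def)
  from bchoice[OF this] obtain a where
    "\<forall>k\<in>?J. (\<exists>p\<in>P. a k p \<noteq> 0) \<and> (\<forall>q\<in>Q. (\<Sum>p\<in>P. symbol (?z k) q p * a k p) = 0)" ..
  then have a: "\<And>k. k \<in> ?J \<Longrightarrow> \<exists>p\<in>P. a k p \<noteq> 0"
    and sym: "\<And>k q. k \<in> ?J \<Longrightarrow> q \<in> Q \<Longrightarrow> (\<Sum>p\<in>P. symbol (?z k) q p * a k p) = 0"
    by blast+
  define u where "u k p n = monomial (?z k) n * a k p" for k p n
  have ker: "conv (u k) q n = 0" if "k \<in> ?J" "q \<in> Q" for k q n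
    using sym[OF that] unfolding u_def by (simp add: conv_wave)
  have indep: "c i = 0"
    if c: "\<And>p n. p \<in> P \<Longrightarrow> n \<in> lattice_box 0 (int L) \<Longrightarrow> (\<Sum>j\<in>?J. u j p n * c j) = 0" and i: "i \<in> ?J"
    for c i
  proof -
    have "0 = (\<Sum>p\<in>P. \<Sum>n\<in>lattice_box 0 (int L). cnj (u i p n) * (\<Sum>j\<in>?J. u j p n * c j))"
      using c by simp
    also have "\<dots> = (\<Sum>p\<in>P. \<Sum>j\<in>?J. cnj (a i p) * a j p * c j *
        (\<Sum>n\<in>lattice_box 0 (int L). cnj (monomial (?z i) n) * monomial (?z j) n))"
      unfolding u_def sum_distrib_left by (subst sum.swap) (simp add: algebra_simps)
    also have "\<dots> = (\<Sum>p\<in>P. \<Sum>j\<in>?J. if i = j then cnj (a i p) * a i p * c i * of_nat L ^ CARD('d) else 0)"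
      using i by (intro sum.cong refl) (simp add: grid_characters_orthogonal)
    also have "\<dots> = (\<Sum>p\<in>P. cnj (a i p) * a i p * c i * of_nat L ^ CARD('d))"
      using i fin by (intro sum.cong refl) simp
    also have "\<dots> = of_real (\<Sum>p\<in>P. (cmod (a i p))\<^sup>2) * (c i * of_nat L ^ CARD('d))"
      using inner_on_self[of P "a i"] unfolding inner_on_def
      by (metis (no_types, lifting) mult.assoc sum.cong sum_distrib_right)
    finally have "of_real (\<Sum>p\<in>P. (cmod (a i p))\<^sup>2) * (c i * of_nat L ^ CARD('d)) = 0" ..
    moreover have "0 < (\<Sum>p\<in>P. (cmod (a i p))\<^sup>2)"
      using a[OF i] finite_P by (auto intro: sum_pos2)
    ultimately have "c i * of_nat L ^ CARD('d) = 0"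
      by (metis less_irrefl mult_eq_0_iff of_real_eq_0_iff)
    then show ?thesis using L by simp
  qed
  have "card ?J \<le> card (Q \<times> box_boundary S L)"
  proof (rule card_le_if_kernel_trivial[OF fin])
    show "finite (Q \<times> box_boundary S L)"
      by (simp add: finite_Q finite_S)
    show "c i = 0"
      if "\<And>r. r \<in> Q \<times> box_boundary S L \<Longrightarrow>
          (\<Sum>j\<in>?J. conv (truncate L (u j)) (fst r) (snd r) * c j) = 0" and "i \<in> ?J" for c i
      by (rule indep[OF vanishing_boundary_values[OF ker that(1)] that(2)])
  qed
  then show ?thesis by (simp add: card_cartesian_product)
qed

text \<open>
  Letting \<open>L\<close> tend to infinity, the density of singular points in every grid tends to zero uniformly,
  and averaging over grids transfers this to the measure. The subset \<open>A\<close> takes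
  the place of the set of singular angles so that measurability can be supplied separately; below it
  comes from the continuity of a determinant.
\<close>

theorem singular_angles_null:
  assumes A: "A \<in> sets borel" "A \<subseteq> singular_angles"
  shows "emeasure lborel (A \<inter> cbox 0 (\<chi> i. 2 * pi)) = 0"
proof -
  let ?b = "\<lambda>L. (2 * pi) ^ CARD('d) * (real (card Q * card (box_boundary S L)) / real L ^ CARD('d))"
  have "emeasure lborel (A \<inter> cbox 0 (\<chi> i. 2 * pi)) \<le> ennreal (?b L)" if L: "0 < L" for L
  proof (rule emeasure_le_grid_count[OF A(1) L])
    fix t
    have "card {k \<in> lattice_box 0 (int L). t + grid_step L k \<in> A} \<le>
        card {k \<in> lattice_box 0 (int L). t + grid_step L k \<in> singular_angles}"
      using A(2) by (intro card_mono) auto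
    also note card_singular_grid_points[OF L]
    finally show "card {k \<in> lattice_box 0 (int L). t + grid_step L k \<in> A}
        \<le> card Q * card (box_boundary S L)" .
  qed
  then have "\<exists>N. \<forall>L\<ge>N. emeasure lborel (A \<inter> cbox 0 (\<chi> i. 2 * pi)) \<le> ennreal (?b L)"
    by (intro exI[of _ 1]) auto
  moreover have "(\<lambda>L. ennreal (?b L)) \<longlonglongrightarrow> ennreal 0"
  proof (rule tendsto_ennrealI)
    have "(\<lambda>L. (2 * pi) ^ CARD('d) * (real (card Q) * (real (card (box_boundary S L)) / real L ^ CARD('d))))
        \<longlonglongrightarrow> (2 * pi) ^ CARD('d) * (real (card Q) * 0)"
      by (intro tendsto_intros box_boundary_density finite_S)
    then show "?b \<longlonglongrightarrow> 0" by simp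
  qed
  ultimately have "emeasure lborel (A \<inter> cbox 0 (\<chi> i. 2 * pi)) \<le> ennreal 0"
    by (intro LIMSEQ_le_const)
  then show ?thesis by simp
qed

text \<open>
  The singular angles cannot fill a cube of positive measure, and at any other angle the symbol is
  injective.
\<close>

corollary card_le: "card P \<le> card Q"
proof -
  have "singular_angles \<noteq> UNIV"
  proof
    assume *: "singular_angles = UNIV"
    have "emeasure lborel (UNIV \<inter> cbox 0 (\<chi> i. 2 * pi) :: (real ^ 'd) set) = 0"
      by (rule singular_angles_null) (use * in auto)
    then show False by (simp add: emeasure_lborel_cube)
  qed
  then obtain t where t: "t \<notin> singular_angles" by blast
  show ?thesis
  proof (rule card_le_if_kernel_trivial[OF finite_P finite_Q])
    show "c p = 0"
      if "\<And>q. q \<in> Q \<Longrightarrow> (\<Sum>p\<in>P. symbol (torus_point t) q p * c p) = 0" and "p \<in> P" for c p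
      using t that unfolding singular_angles_def by blast
  qed
qed

end

section \<open>The rigidity operators of a crystal framework\<close>

text \<open>
  Rigidity entries depend only on differences of positions.
\<close>

lemma rigidity_entry_translate:
  assumes "inj_on f e" "v \<in> e" and "\<And>x. x \<in> e \<Longrightarrow> p (f x) = p x + b"
  shows "rigidity_entry p (f ` e) (f v) = rigidity_entry p e v"
proof -
  have "(\<Sum>x\<in>f ` e. p (f v) - p x) = (\<Sum>x\<in>e. p (f v) - p (f x))"
    by (rule sum.reindex[OF assms(1), unfolded o_def])
  also have "\<dots> = (\<Sum>x\<in>e. p v - p x)"
    using assms by (intro sum.cong) auto
  finally show ?thesis
    using assms(2) by (simp add: rigidity_entry_def)
qed

lemma square_summable_reindex:
  fixes f :: "'i \<Rightarrow> 'b::real_normed_vector"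
  assumes "square_summable f" "inj g"
  shows "(\<lambda>n. (norm (f (g n)))\<^sup>2) summable_on UNIV"
proof -
  have "(\<lambda>i. (norm (f i))\<^sup>2) summable_on range g"
    using assms(1) unfolding square_summable_def by (rule summable_on_subset_banach) simp
  then show ?thesis
    using summable_on_reindex[OF assms(2), of "\<lambda>i. (norm (f i))\<^sup>2"] by (simp add: o_def)
qed

context crystal_framework
begin

lemma translate_closed: "v \<in> V \<Longrightarrow> T n v \<in> V"
proof -
  assume "v \<in> V"
  then obtain m \<kappa> where "\<kappa> \<in> F\<^sub>v" "v = T m \<kappa>"
    using cover_vertices by blast
  then have "T n v = T (n + m) \<kappa>"
    using action_add F\<^sub>v by auto
  then show "T n v \<in> V"
    using \<open>\<kappa> \<in> F\<^sub>v\<close> cover_vertices by blast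
qed

lemma translate_inverse: "v \<in> V \<Longrightarrow> T (- n) (T n v) = v"
  by (metis action_add action_zero add.left_inverse)

lemma inj_on_translate: "inj_on (T n) V"
  by (rule inj_on_inverseI[where g = "T (- n)"]) (rule translate_inverse)

lemma vertex_cases:
  assumes "v \<in> V"
  obtains n \<kappa> where "\<kappa> \<in> F\<^sub>v" "v = T n \<kappa>"
  using assms cover_vertices by blast

lemma edge_endpoints: "\<forall>e\<in>E. \<exists>v w. v \<in> V \<and> w \<in> V \<and> v \<noteq> w \<and> e = {v, w}"
  using framework by (simp add: bar_joint_framework_def simple_graph_def)

lemma edge_subset: "e \<in> E \<Longrightarrow> e \<subseteq> V"
  by (drule bspec[OF edge_endpoints]) auto

lemma finite_edge: "e \<in> E \<Longrightarrow> finite e"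
  by (drule bspec[OF edge_endpoints]) auto

lemma motif_edge: "e \<in> F\<^sub>e \<Longrightarrow> e \<in> E" "e \<in> F\<^sub>e \<Longrightarrow> e \<subseteq> V" "e \<in> F\<^sub>e \<Longrightarrow> finite e"
  using F\<^sub>e edge_subset finite_edge by auto

lemma edge_cases:
  assumes "e \<in> E"
  obtains n f where "f \<in> F\<^sub>e" "e = T n ` f"
  using assms cover_edges by blast

lemma translate_edge_mem: "e \<in> F\<^sub>e \<Longrightarrow> T n ` e \<in> E"
  using cover_edges by blast

lemma translate_edge_eq_iff:
  assumes "e \<in> F\<^sub>e" "f \<in> F\<^sub>e"
  shows "T m ` e = T n ` f \<longleftrightarrow> m = n \<and> e = f"
proof
  assume eq: "T m ` e = T n ` f"
  have mn: "m = n"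
  proof (rule ccontr)
    assume "m \<noteq> n"
    then show False
      using disjoint_edges[of m n] assms eq by blast
  qed
  then have "e = f"
    using eq assms motif_edge(2) by (metis inj_on_image_eq_iff inj_on_translate)
  with mn show "m = n \<and> e = f" ..
qed auto

lemma motif_vertex: "\<kappa> \<in> F\<^sub>v \<Longrightarrow> \<kappa> \<in> V"
  using F\<^sub>v by auto

text \<open>
  The lattice vectors \<open>m\<close> for which some vertex \<open>\<kappa> + m\<close> belongs to an edge of the motif: edges
  may leave the motif cell, so shifts other than zero occur.
\<close>

definition motif_shifts :: "(int ^ 'd) set" where
  "motif_shifts = {m. \<exists>\<kappa>\<in>F\<^sub>v. \<exists>e\<in>F\<^sub>e. T m \<kappa> \<in> e}"

lemma finite_motif_shifts: "finite motif_shifts"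
proof -
  have "finite ((\<lambda>m. T m \<kappa>) -` (\<Union>F\<^sub>e))" if "\<kappa> \<in> F\<^sub>v" for \<kappa>
  proof (rule finite_vimageI)
    show "finite (\<Union>F\<^sub>e)"
      using F\<^sub>e motif_edge(3) by auto
    show "inj (\<lambda>m. T m \<kappa>)"
      using that by (auto intro!: injI simp: translate_eq_iff)
  qed
  then have "finite (\<Union>\<kappa>\<in>F\<^sub>v. (\<lambda>m. T m \<kappa>) -` (\<Union>F\<^sub>e))"
    using F\<^sub>v by auto
  moreover have "motif_shifts \<subseteq> (\<Union>\<kappa>\<in>F\<^sub>v. (\<lambda>m. T m \<kappa>) -` (\<Union>F\<^sub>e))"
    by (auto simp: motif_shifts_def)
  ultimately show ?thesis by (rule rev_finite_subset)
qed

text \<open>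
  In the coordinates given by the group action, the rigidity matrix becomes a convolution operator
  with these coefficients, and its transpose the one with the indices exchanged and the shift
  negated; the two sublocale declarations record this.
\<close>

definition rigidity_kernel :: "'v set \<Rightarrow> 'v \<times> 'd \<Rightarrow> int ^ 'd \<Rightarrow> complex" where
  "rigidity_kernel e = (\<lambda>(\<kappa>, i) m.
     if T m \<kappa> \<in> e then cvec (rigidity_entry p e (T m \<kappa>)) $ i else 0)"

sublocale flex: finite_range_operator "F\<^sub>v \<times> UNIV" F\<^sub>e motif_shifts rigidity_kernel
  by unfold_locales (use F\<^sub>v F\<^sub>e finite_motif_shifts in auto)

sublocale stress: finite_range_operator F\<^sub>e "F\<^sub>v \<times> UNIV" "uminus ` motif_shifts"
    "\<lambda>k e m. rigidity_kernel e k (- m)"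
  by unfold_locales (use F\<^sub>v F\<^sub>e finite_motif_shifts in auto)

lemma rigidity_entry_translate_edge:
  assumes "e \<in> F\<^sub>e" "v \<in> e"
  shows "rigidity_entry p (T n ` e) (T n v) = rigidity_entry p e v"
  using assms motif_edge(2)
  by (intro rigidity_entry_translate[where b = "lattice_vec a n"])
    (auto intro: inj_on_subset[OF inj_on_translate] action_translation)

text \<open>
  Every vertex is a unique translate of a unique motif vertex, so the endpoints of an edge can be
  listed by motif vertex and shift.
\<close>

lemma sum_over_edge:
  assumes e: "e \<in> F\<^sub>e"
  shows "sum g e = (\<Sum>\<kappa>\<in>F\<^sub>v. \<Sum>m\<in>motif_shifts. if T m \<kappa> \<in> e then g (T m \<kappa>) else 0)"
proof -
  let ?X = "{(\<kappa>, m) \<in> F\<^sub>v \<times> motif_shifts. T m \<kappa> \<in> e}"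
  have "bij_betw (\<lambda>(\<kappa>, m). T m \<kappa>) ?X e"
  proof (rule bij_betw_imageI)
    show "inj_on (\<lambda>(\<kappa>, m). T m \<kappa>) ?X"
      by (auto intro!: inj_onI simp: translate_eq_iff)
    show "(\<lambda>(\<kappa>, m). T m \<kappa>) ` ?X = e"
    proof
      show "e \<subseteq> (\<lambda>(\<kappa>, m). T m \<kappa>) ` ?X"
      proof
        fix v assume v: "v \<in> e"
        then obtain n \<kappa> where \<kappa>: "\<kappa> \<in> F\<^sub>v" "v = T n \<kappa>"
          using motif_edge(2)[OF e] vertex_cases by blast
        then have "n \<in> motif_shifts"
          using v e by (auto simp: motif_shifts_def)
        then show "v \<in> (\<lambda>(\<kappa>, m). T m \<kappa>) ` ?X"
          using \<kappa> v by (intro image_eqI[of _ _ "(\<kappa>, n)"]) auto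
      qed
    qed auto
  qed
  then have "sum g e = (\<Sum>(\<kappa>, m)\<in>?X. g (T m \<kappa>))"
    by (simp add: sum.reindex_bij_betw[symmetric] case_prod_unfold)
  also have "\<dots> = (\<Sum>(\<kappa>, m)\<in>F\<^sub>v \<times> motif_shifts. if T m \<kappa> \<in> e then g (T m \<kappa>) else 0)"
    using F\<^sub>v finite_motif_shifts by (intro sum.mono_neutral_cong_left) (auto split: if_splits)
  finally show ?thesis
    by (simp add: sum.cartesian_product)
qed

definition vertex_coords :: "('v \<Rightarrow> complex ^ 'd) \<Rightarrow> 'v \<times> 'd \<Rightarrow> int ^ 'd \<Rightarrow> complex" where
  "vertex_coords u = (\<lambda>(\<kappa>, i) n. u (T n \<kappa>) $ i)"

definition edge_coords :: "('v set \<Rightarrow> complex) \<Rightarrow> 'v set \<Rightarrow> int ^ 'd \<Rightarrow> complex" where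
  "edge_coords s e n = s (T n ` e)"

lemma rigidity_map_conv:
  assumes e: "e \<in> F\<^sub>e"
  shows "rigidity_map p u (T n ` e) = flex.conv (vertex_coords u) e n"
proof -
  have inj: "inj_on (T n) e"
    using inj_on_subset[OF inj_on_translate motif_edge(2)[OF e]] .
  have "rigidity_map p u (T n ` e) = (\<Sum>v\<in>e. cdot (cvec (rigidity_entry p e v)) (u (T n v)))"
    unfolding rigidity_map_def
    by (subst sum.reindex[OF inj]) (simp add: rigidity_entry_translate_edge e)
  also have "\<dots> = (\<Sum>\<kappa>\<in>F\<^sub>v. \<Sum>m\<in>motif_shifts.
      if T m \<kappa> \<in> e then cdot (cvec (rigidity_entry p e (T m \<kappa>))) (u (T n (T m \<kappa>))) else 0)"
    by (rule sum_over_edge[OF e])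
  also have "\<dots> = (\<Sum>\<kappa>\<in>F\<^sub>v. \<Sum>m\<in>motif_shifts. \<Sum>i\<in>UNIV.
      rigidity_kernel e (\<kappa>, i) m * vertex_coords u (\<kappa>, i) (n + m))"
    by (intro sum.cong refl)
      (auto simp: cdot_def rigidity_kernel_def vertex_coords_def action_add motif_vertex)
  also have "\<dots> = (\<Sum>\<kappa>\<in>F\<^sub>v. \<Sum>i\<in>UNIV. \<Sum>m\<in>motif_shifts.
      rigidity_kernel e (\<kappa>, i) m * vertex_coords u (\<kappa>, i) (n + m))"
    by (rule sum.cong[OF refl], rule sum.swap)
  also have "\<dots> = flex.conv (vertex_coords u) e n"
    unfolding flex.conv_def by (subst sum.cartesian_product) (simp add: case_prod_unfold)
  finally show ?thesis .
qed

text \<open>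
  The edges at the vertex \<open>\<kappa> + n\<close> are the translates, by \<open>n + l\<close>, of those motif edges that contain
  \<open>\<kappa> - l\<close>.
\<close>

lemma rigidity_transpose_conv:
  assumes \<kappa>: "\<kappa> \<in> F\<^sub>v"
  shows "rigidity_transpose E p s (T n \<kappa>) $ i = stress.conv (edge_coords s) (\<kappa>, i) n"
proof -
  let ?X = "{(e, l) \<in> F\<^sub>e \<times> uminus ` motif_shifts. T (- l) \<kappa> \<in> e}"
  have shift: "T (n + l) (T (- l) \<kappa>) = T n \<kappa>" for l
    using action_add[OF motif_vertex[OF \<kappa>], of "n + l" "- l"] by simp
  have "bij_betw (\<lambda>(e, l). T (n + l) ` e) ?X {e \<in> E. T n \<kappa> \<in> e}"
  proof (rule bij_betw_imageI)
    show "inj_on (\<lambda>(e, l). T (n + l) ` e) ?X"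
      by (auto intro!: inj_onI simp: translate_edge_eq_iff)
    show "(\<lambda>(e, l). T (n + l) ` e) ` ?X = {e \<in> E. T n \<kappa> \<in> e}"
    proof
      show "(\<lambda>(e, l). T (n + l) ` e) ` ?X \<subseteq> {e \<in> E. T n \<kappa> \<in> e}"
      proof (clarsimp simp: translate_edge_mem)
        fix e m assume "T m \<kappa> \<in> e"
        then have "T (n - m) (T m \<kappa>) \<in> T (n - m) ` e" by (rule imageI)
        then show "T n \<kappa> \<in> T (n - m) ` e" using shift[of "- m"] by simp
      qed
      show "{e \<in> E. T n \<kappa> \<in> e} \<subseteq> (\<lambda>(e, l). T (n + l) ` e) ` ?X"
      proof
        fix e' assume "e' \<in> {e \<in> E. T n \<kappa> \<in> e}"
        then have "e' \<in> E" and mem: "T n \<kappa> \<in> e'" by auto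
        from this(1) obtain m e where e: "e \<in> F\<^sub>e" "e' = T m ` e" by (rule edge_cases)
        with mem obtain v where v: "v \<in> e" "T n \<kappa> = T m v" by blast
        then have "v = T (- m) (T n \<kappa>)"
          using translate_inverse motif_edge(2)[OF e(1)] by force
        also have "\<dots> = T (n - m) \<kappa>"
          using action_add[OF motif_vertex[OF \<kappa>], of "- m" n] by simp
        finally have "T (n - m) \<kappa> \<in> e" using v by simp
        moreover from this have "n - m \<in> motif_shifts"
          using \<kappa> e by (auto simp: motif_shifts_def)
        then have "m - n \<in> uminus ` motif_shifts"
          by (intro image_eqI[of _ _ "n - m"]) auto
        ultimately show "e' \<in> (\<lambda>(e, l). T (n + l) ` e) ` ?X"
          using e by (intro image_eqI[of _ _ "(e, m - n)"]) auto
      qed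
    qed
  qed
  then have "rigidity_transpose E p s (T n \<kappa>) =
      (\<Sum>(e, l)\<in>?X. s (T (n + l) ` e) *s cvec (rigidity_entry p (T (n + l) ` e) (T n \<kappa>)))"
    unfolding rigidity_transpose_def
    by (subst sum.reindex_bij_betw[symmetric, where h = "\<lambda>(e, l). T (n + l) ` e" and S = ?X])
      (simp_all add: case_prod_unfold)
  also have "\<dots> = (\<Sum>(e, l)\<in>?X. s (T (n + l) ` e) *s cvec (rigidity_entry p e (T (- l) \<kappa>)))"
  proof (rule sum.cong[OF refl], clarify)
    fix e m assume "e \<in> F\<^sub>e" "T (- (- m)) \<kappa> \<in> e"
    then show "s (T (n + - m) ` e) *s cvec (rigidity_entry p (T (n + - m) ` e) (T n \<kappa>)) =
        s (T (n + - m) ` e) *s cvec (rigidity_entry p e (T (- (- m)) \<kappa>))"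
      using rigidity_entry_translate_edge[of e "T (- (- m)) \<kappa>" "n + - m"] shift[of "- m"] by simp
  qed
  finally have "rigidity_transpose E p s (T n \<kappa>) $ i =
      (\<Sum>(e, l)\<in>?X. rigidity_kernel e (\<kappa>, i) (- l) * edge_coords s e (n + l))"
    by (simp add: case_prod_unfold sum_component rigidity_kernel_def edge_coords_def mult.commute)
  also have "\<dots> = (\<Sum>(e, l)\<in>F\<^sub>e \<times> uminus ` motif_shifts.
      rigidity_kernel e (\<kappa>, i) (- l) * edge_coords s e (n + l))"
    using F\<^sub>e finite_motif_shifts
    by (intro sum.mono_neutral_left) (auto simp: rigidity_kernel_def split: if_splits)
  finally show ?thesis
    by (simp add: stress.conv_def sum.cartesian_product)
qed

lemma infinitesimal_flex_iff:
  "infinitesimal_flex V E p u \<longleftrightarrow>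
    (\<forall>v. v \<notin> V \<longrightarrow> u v = 0) \<and> (\<forall>e\<in>F\<^sub>e. \<forall>n. flex.conv (vertex_coords u) e n = 0)"
  unfolding infinitesimal_flex_def
  by (metis edge_cases rigidity_map_conv translate_edge_mem)

lemma self_stress_iff:
  "self_stress V E p s \<longleftrightarrow>
    (\<forall>e. e \<notin> E \<longrightarrow> s e = 0) \<and> (\<forall>k\<in>F\<^sub>v \<times> UNIV. \<forall>n. stress.conv (edge_coords s) k n = 0)"
proof -
  have "(\<forall>v\<in>V. rigidity_transpose E p s v = 0) \<longleftrightarrow>
      (\<forall>\<kappa>\<in>F\<^sub>v. \<forall>n i. rigidity_transpose E p s (T n \<kappa>) $ i = 0)"
    unfolding Finite_Cartesian_Product.vec_eq_iff
    by (metis motif_vertex translate_closed vertex_cases zero_index)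
  then show ?thesis
    by (auto simp: self_stress_def rigidity_transpose_conv)
qed

text \<open>
  The inverse of \<open>vertex_coords\<close> on fields supported on the vertices. The choice is of the unique
  representation of \<open>v\<close> as a translate of a motif vertex.
\<close>

definition vertex_field :: "('v \<times> 'd \<Rightarrow> int ^ 'd \<Rightarrow> complex) \<Rightarrow> 'v \<Rightarrow> complex ^ 'd" where
  "vertex_field x v = (if v \<in> V then
     (case SOME (\<kappa>, n). \<kappa> \<in> F\<^sub>v \<and> v = T n \<kappa> of (\<kappa>, n) \<Rightarrow> \<chi> i. x (\<kappa>, i) n) else 0)"

lemma vertex_field_translate:
  assumes "\<kappa> \<in> F\<^sub>v"
  shows "vertex_field x (T n \<kappa>) = (\<chi> i. x (\<kappa>, i) n)"
proof -
  have "(SOME (\<kappa>', n'). \<kappa>' \<in> F\<^sub>v \<and> T n \<kappa> = T n' \<kappa>') = (\<kappa>, n)"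
    by (rule some_equality) (use assms in \<open>auto simp: translate_eq_iff\<close>)
  then show ?thesis
    using translate_closed[OF motif_vertex[OF assms]] by (simp add: vertex_field_def)
qed

definition edge_field :: "('v set \<Rightarrow> int ^ 'd \<Rightarrow> complex) \<Rightarrow> 'v set \<Rightarrow> complex" where
  "edge_field x e = (if e \<in> E then
     (case SOME (f, n). f \<in> F\<^sub>e \<and> e = T n ` f of (f, n) \<Rightarrow> x f n) else 0)"

lemma edge_field_translate:
  assumes "f \<in> F\<^sub>e"
  shows "edge_field x (T n ` f) = x f n"
proof -
  have "(SOME (f', n'). f' \<in> F\<^sub>e \<and> T n ` f = T n' ` f') = (f, n)"
    by (rule some_equality) (use assms in \<open>auto simp: translate_edge_eq_iff\<close>)
  then show ?thesis
    using translate_edge_mem[OF assms] by (simp add: edge_field_def)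
qed

lemma flex_conv_vertex_field:
  "flex.conv (vertex_coords (vertex_field x)) e n = flex.conv x e n"
  unfolding flex.conv_def
  by (intro sum.cong refl) (auto simp: vertex_coords_def vertex_field_translate)

lemma stress_conv_edge_field:
  "stress.conv (edge_coords (edge_field x)) k n = stress.conv x k n"
  unfolding stress.conv_def
  by (intro sum.cong refl) (auto simp: edge_coords_def edge_field_translate)

lemma flex_finitely_injective:
  assumes "\<And>u. infinitesimal_flex V E p u \<Longrightarrow> finitely_supported u \<Longrightarrow> u = 0"
  shows "finitely_injective_operator (F\<^sub>v \<times> UNIV) F\<^sub>e motif_shifts rigidity_kernel"
proof unfold_locales
  fix x k n
  assume fin: "\<And>k. k \<in> F\<^sub>v \<times> UNIV \<Longrightarrow> finite {n. x k n \<noteq> 0}"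
    and ker: "\<And>e n. e \<in> F\<^sub>e \<Longrightarrow> flex.conv x e n = 0"
    and k: "k \<in> F\<^sub>v \<times> (UNIV :: 'd set)"
  have "infinitesimal_flex V E p (vertex_field x)"
    unfolding infinitesimal_flex_iff flex_conv_vertex_field
    using ker by (simp add: vertex_field_def)
  moreover have "{v. vertex_field x v \<noteq> 0} \<subseteq>
      (\<Union>k\<in>F\<^sub>v \<times> UNIV. (\<lambda>n. T n (fst k)) ` {n. x k n \<noteq> 0})"
  proof
    fix v assume v: "v \<in> {v. vertex_field x v \<noteq> 0}"
    then have "v \<in> V" by (auto simp: vertex_field_def split: if_splits)
    then obtain n \<kappa> where \<kappa>: "\<kappa> \<in> F\<^sub>v" "v = T n \<kappa>" by (rule vertex_cases)
    with v obtain i where "x (\<kappa>, i) n \<noteq> 0"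
      by (auto simp: vertex_field_translate Finite_Cartesian_Product.vec_eq_iff)
    then show "v \<in> (\<Union>k\<in>F\<^sub>v \<times> UNIV. (\<lambda>n. T n (fst k)) ` {n. x k n \<noteq> 0})"
      using \<kappa> by force
  qed
  then have "finitely_supported (vertex_field x)"
    unfolding finitely_supported_def
    by (rule finite_subset) (use fin F\<^sub>v in auto)
  ultimately have "vertex_field x = 0" by (rule assms)
  then have "vertex_coords (vertex_field x) k n = 0"
    by (simp add: vertex_coords_def case_prod_unfold)
  then show "x k n = 0"
    using k by (auto simp: vertex_coords_def vertex_field_translate)
qed

lemma stress_finitely_injective:
  assumes "\<And>s. self_stress V E p s \<Longrightarrow> finitely_supported s \<Longrightarrow> s = 0"
  shows "finitely_injective_operator F\<^sub>e (F\<^sub>v \<times> UNIV) (uminus ` motif_shifts)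
    (\<lambda>k e m. rigidity_kernel e k (- m))"
proof unfold_locales
  fix x e n
  assume fin: "\<And>e. e \<in> F\<^sub>e \<Longrightarrow> finite {n. x e n \<noteq> 0}"
    and ker: "\<And>k n. k \<in> F\<^sub>v \<times> UNIV \<Longrightarrow> stress.conv x k n = 0"
    and e: "e \<in> F\<^sub>e"
  have "self_stress V E p (edge_field x)"
    unfolding self_stress_iff stress_conv_edge_field
    using ker by (simp add: edge_field_def)
  moreover have "{e. edge_field x e \<noteq> 0} \<subseteq> (\<Union>f\<in>F\<^sub>e. (\<lambda>n. T n ` f) ` {n. x f n \<noteq> 0})"
  proof
    fix e assume e: "e \<in> {e. edge_field x e \<noteq> 0}"
    then have "e \<in> E" by (auto simp: edge_field_def split: if_splits)
    then obtain n f where "f \<in> F\<^sub>e" "e = T n ` f" by (rule edge_cases)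
    with e show "e \<in> (\<Union>f\<in>F\<^sub>e. (\<lambda>n. T n ` f) ` {n. x f n \<noteq> 0})"
      by (auto simp: edge_field_translate)
  qed
  then have "finitely_supported (edge_field x)"
    unfolding finitely_supported_def
    by (rule finite_subset) (use fin F\<^sub>e in auto)
  ultimately have "edge_field x = 0" by (rule assms)
  then show "x e n = 0"
    using edge_field_translate[OF e, of x n] by simp
qed

lemma square_summable_flex_zero:
  assumes "\<And>u. infinitesimal_flex V E p u \<Longrightarrow> finitely_supported u \<Longrightarrow> u = 0"
    and u: "infinitesimal_flex V E p u" "square_summable u"
  shows "u = 0"
proof
  interpret finitely_injective_operator "F\<^sub>v \<times> UNIV" F\<^sub>e motif_shifts rigidity_kernel
    by (rule flex_finitely_injective) (rule assms)
  have summable: "(\<lambda>n. (cmod (vertex_coords u k n))\<^sup>2) summable_on UNIV" if k: "k \<in> F\<^sub>v \<times> UNIV" for k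
  proof (rule summable_on_comparison_test)
    show "(\<lambda>n. (norm (u (T n (fst k))))\<^sup>2) summable_on UNIV"
      using k by (intro square_summable_reindex[OF u(2)] injI) (auto simp: translate_eq_iff)
    show "(cmod (vertex_coords u k n))\<^sup>2 \<le> (norm (u (T n (fst k))))\<^sup>2" for n
      by (auto simp: vertex_coords_def case_prod_unfold intro!: power_mono component_le_norm_cart
          Finite_Cartesian_Product.norm_nth_le)
  qed auto
  fix v
  show "u v = 0 v"
  proof (cases "v \<in> V")
    case True
    then obtain n \<kappa> where \<kappa>: "\<kappa> \<in> F\<^sub>v" "v = T n \<kappa>" by (rule vertex_cases)
    have "vertex_coords u (\<kappa>, i) n = 0" for i
    proof (rule square_summable_kernel_trivial[OF _ summable])
      show "flex.conv (vertex_coords u) e n = 0" if "e \<in> F\<^sub>e" for e n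
        using u(1) that by (simp add: infinitesimal_flex_iff)
    qed (use \<kappa> in auto)
    then show ?thesis
      using \<kappa> by (simp add: vertex_coords_def Finite_Cartesian_Product.vec_eq_iff)
  next
    case False
    then show ?thesis using u(1) by (simp add: infinitesimal_flex_def)
  qed
qed

lemma square_summable_stress_zero:
  assumes "\<And>s. self_stress V E p s \<Longrightarrow> finitely_supported s \<Longrightarrow> s = 0"
    and s: "self_stress V E p s" "square_summable s"
  shows "s = 0"
proof
  interpret finitely_injective_operator F\<^sub>e "F\<^sub>v \<times> UNIV" "uminus ` motif_shifts"
      "\<lambda>k e m. rigidity_kernel e k (- m)"
    by (rule stress_finitely_injective) (rule assms)
  have summable: "(\<lambda>n. (cmod (edge_coords s e n))\<^sup>2) summable_on UNIV" if "e \<in> F\<^sub>e" for e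
    unfolding edge_coords_def
    using that by (intro square_summable_reindex[OF s(2)] injI) (auto simp: translate_edge_eq_iff)
  fix e
  show "s e = 0 e"
  proof (cases "e \<in> E")
    case True
    then obtain n f where f: "f \<in> F\<^sub>e" "e = T n ` f" by (rule edge_cases)
    have "edge_coords s f n = 0"
    proof (rule square_summable_kernel_trivial[OF _ summable])
      show "stress.conv (edge_coords s) k n = 0" if "k \<in> F\<^sub>v \<times> UNIV" for k n
        using s(1) that unfolding self_stress_iff by blast
    qed (use f in auto)
    then show ?thesis
      using f by (simp add: edge_coords_def)
  next
    case False
    then show ?thesis using s(1) by (simp add: self_stress_def)
  qed
qed

theorem square_summably_isostaticI:
  assumes "\<And>u. infinitesimal_flex V E p u \<Longrightarrow> finitely_supported u \<Longrightarrow> u = 0"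
    and "\<And>s. self_stress V E p s \<Longrightarrow> finitely_supported s \<Longrightarrow> s = 0"
  shows "square_summably_isostatic V E p"
  unfolding square_summably_isostatic_def
  using square_summable_flex_zero[OF assms(1)] square_summable_stress_zero[OF assms(2)] by blast

text \<open>
  Absence of internal flexes makes the symbol injective somewhere, absence of internal stresses does
  the same for the symbol of the transpose; each gives one inequality.
\<close>

theorem Maxwell_count:
  assumes "\<And>u. infinitesimal_flex V E p u \<Longrightarrow> finitely_supported u \<Longrightarrow> u = 0"
    and "\<And>s. self_stress V E p s \<Longrightarrow> finitely_supported s \<Longrightarrow> s = 0"
  shows "CARD('d) * card F\<^sub>v = card F\<^sub>e"
proof -
  have "card (F\<^sub>v \<times> (UNIV :: 'd set)) \<le> card F\<^sub>e"
    by (rule finitely_injective_operator.card_le, rule flex_finitely_injective) (rule assms(1))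
  moreover have "card F\<^sub>e \<le> card (F\<^sub>v \<times> (UNIV :: 'd set))"
    by (rule finitely_injective_operator.card_le, rule stress_finitely_injective) (rule assms(2))
  ultimately show ?thesis by (simp add: card_cartesian_product mult.commute)
qed

end

section \<open>The symbol matrix and wave flexes\<close>

lemma torus_point_in_torus: "torus_point t \<in> torus"
  by (simp add: torus_point_def torus_def)

lemma torusE:
  assumes "\<omega> \<in> torus"
  obtains t where "\<omega> = torus_point t"
proof
  have "cis (Arg (\<omega> $ i)) = \<omega> $ i" for i
    using assms rcis_cmod_Arg[of "\<omega> $ i"] by (simp add: rcis_def torus_def)
  then show "\<omega> = torus_point (\<chi> i. Arg (\<omega> $ i))"
    by (simp add: torus_point_def Finite_Cartesian_Product.vec_eq_iff)
qed

lemma monomial_torus_nonzero: "monomial (torus_point t) n \<noteq> 0"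
  by (simp add: monomial_torus_point)

lemma closed_torus: "closed (torus :: (complex ^ 'd) set)"
  unfolding torus_def by (intro closed_Collect_all closed_Collect_eq continuous_intros)

lemma continuous_on_monomial_cnj:
  "continuous_on torus (\<lambda>z :: complex ^ 'd. monomial (\<chi> i. cnj (z $ i)) m)"
proof -
  have "z $ i \<noteq> 0" if "z \<in> torus" for z :: "complex ^ 'd" and i
    using that by (auto simp: torus_def dest!: spec[of _ i])
  then show ?thesis
    unfolding monomial_def by (auto intro!: continuous_intros)
qed

text \<open>
  The symbol function is built from conjugate powers of \<open>z\<close>, whereas the action on waves is by powers
  of the phase factor. The rigidity entries being real, the two differ by complex conjugation of the
  whole matrix. This lemma is the source of all conjugations below.
\<close>

lemma cnj_monomial: "cnj (monomial (\<chi> i. cnj (z $ i)) m) = monomial z m"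
  by (simp add: monomial_def)

locale enumerated_crystal = crystal_framework V E p a T F\<^sub>v F\<^sub>e
  for V :: "'v set" and E :: "'v set set" and p :: "'v \<Rightarrow> real ^ 'd" and a :: "'d \<Rightarrow> real ^ 'd"
    and T :: "int ^ 'd \<Rightarrow> 'v \<Rightarrow> 'v" and F\<^sub>v :: "'v set" and F\<^sub>e :: "'v set set" +
  fixes es :: "'v set list" and cs :: "('v \<times> 'd) list"
  assumes rows: "distinct es" "set es = F\<^sub>e"
    and columns: "distinct cs" "set cs = F\<^sub>v \<times> UNIV"
begin

abbreviation "\<Phi> \<equiv> symbol_matrix p T es cs"

lemma length_es: "length es = card F\<^sub>e"
  using rows distinct_card by metis

lemma length_cs: "length cs = CARD('d) * card F\<^sub>v"
  using columns distinct_card[of cs] by (simp add: card_cartesian_product mult.commute)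

lemma symbol_matrix_carrier: "\<Phi> z \<in> carrier_mat (length es) (length cs)"
  by (simp add: symbol_matrix_def)

lemma flex_symbol_eq:
  assumes "e \<in> F\<^sub>e" "\<kappa> \<in> F\<^sub>v"
  shows "flex.symbol z e (\<kappa>, i) = cnj (symbol_row p T z e \<kappa> $ i)"
proof -
  have "{m. T m \<kappa> \<in> e} \<subseteq> motif_shifts"
    using assms by (auto simp: motif_shifts_def)
  then have "(\<Sum>m | T m \<kappa> \<in> e. rigidity_kernel e (\<kappa>, i) m * monomial z m) = flex.symbol z e (\<kappa>, i)"
    unfolding flex.symbol_def
    by (intro sum.mono_neutral_left finite_motif_shifts) (auto simp: rigidity_kernel_def)
  then show ?thesis
    by (simp add: symbol_row_def sum_component rigidity_kernel_def cnj_monomial cvec_def mult.commute)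
qed

text \<open>
  The conjugation makes kernel vectors of the symbol matrix at \<open>\<omega>\<close> correspond to waves with phase
  factor \<open>\<omega>\<close> itself rather than its conjugate.
\<close>

definition amplitude_vec :: "('v \<times> 'd \<Rightarrow> complex) \<Rightarrow> complex Matrix.vec" where
  "amplitude_vec c = Matrix.vec (length cs) (\<lambda>j. cnj (c (cs ! j)))"

lemma amplitude_vec_simps [simp]:
  "amplitude_vec c \<in> carrier_vec (length cs)" "dim_vec (amplitude_vec c) = length cs"
  "j < length cs \<Longrightarrow> Matrix.vec_index (amplitude_vec c) j = cnj (c (cs ! j))"
  by (simp_all add: amplitude_vec_def)

lemma sum_columns: "(\<Sum>j<length cs. f (cs ! j)) = (\<Sum>k\<in>F\<^sub>v \<times> UNIV. f k)"
  using sum.reindex_bij_betw[OF bij_betw_nth[OF columns(1) refl columns(2)[symmetric]], of f]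
  by simp

lemma symbol_matrix_mult:
  assumes "r < length es"
  shows "Matrix.vec_index (\<Phi> z *\<^sub>v amplitude_vec c) r =
    cnj (\<Sum>k\<in>F\<^sub>v \<times> UNIV. flex.symbol z (es ! r) k * c k)"
proof -
  have e: "es ! r \<in> F\<^sub>e" using assms rows by auto
  have "Matrix.vec_index (\<Phi> z *\<^sub>v amplitude_vec c) r =
      (\<Sum>j<length cs. symbol_row p T z (es ! r) (fst (cs ! j)) $ snd (cs ! j) * cnj (c (cs ! j)))"
    using assms by (simp add: symbol_matrix_def amplitude_vec_def scalar_prod_def atLeast0LessThan)
  also have "\<dots> = (\<Sum>k\<in>F\<^sub>v \<times> UNIV. symbol_row p T z (es ! r) (fst k) $ snd k * cnj (c k))"
    by (rule sum_columns)
  also have "\<dots> = cnj (\<Sum>k\<in>F\<^sub>v \<times> UNIV. flex.symbol z (es ! r) k * c k)"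
    using e by (auto simp: flex_symbol_eq intro!: sum.cong)
  finally show ?thesis .
qed

lemma all_rows: "(\<forall>r<length es. P (es ! r)) \<longleftrightarrow> (\<forall>e\<in>F\<^sub>e. P e)"
  by (simp add: rows(2)[symmetric] all_set_conv_all_nth)

lemma amplitude_vec_in_kernel_iff:
  "amplitude_vec c \<in> mat_kernel (\<Phi> z) \<longleftrightarrow>
    (\<forall>e\<in>F\<^sub>e. (\<Sum>k\<in>F\<^sub>v \<times> UNIV. flex.symbol z e k * c k) = 0)"
proof -
  have dim: "dim_row (\<Phi> z) = length es" "dim_col (\<Phi> z) = length cs"
    using symbol_matrix_carrier by auto
  have "amplitude_vec c \<in> mat_kernel (\<Phi> z) \<longleftrightarrow>
      (\<forall>r<length es. Matrix.vec_index (\<Phi> z *\<^sub>v amplitude_vec c) r = 0)"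
    unfolding mat_kernel_def Matrix.vec_eq_iff
    by (simp add: dim del: index_mult_mat_vec)
  also have "\<dots> \<longleftrightarrow> (\<forall>r<length es. (\<Sum>k\<in>F\<^sub>v \<times> UNIV. flex.symbol z (es ! r) k * c k) = 0)"
    by (simp only: symbol_matrix_mult complex_cnj_zero_iff cong: imp_cong)
  also have "\<dots> \<longleftrightarrow> (\<forall>e\<in>F\<^sub>e. (\<Sum>k\<in>F\<^sub>v \<times> UNIV. flex.symbol z e k * c k) = 0)"
    by (rule all_rows)
  finally show ?thesis .
qed

lemma amplitude_vec_surj:
  assumes "v \<in> carrier_vec (length cs)"
  obtains c where "v = amplitude_vec c"
proof
  let ?c = "\<lambda>k. cnj (Matrix.vec_index v (the_inv_into {..<length cs} ((!) cs) k))"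
  have "inj_on ((!) cs) {..<length cs}"
    using columns(1) by (simp add: inj_on_nth)
  then show "v = amplitude_vec ?c"
    using assms by (intro eq_vecI) (simp_all add: the_inv_into_f_f)
qed

lemma amplitude_vec_zero_iff:
  "amplitude_vec c = 0\<^sub>v (length cs) \<longleftrightarrow> (\<forall>k\<in>F\<^sub>v \<times> UNIV. c k = 0)"
proof -
  have "amplitude_vec c = 0\<^sub>v (length cs) \<longleftrightarrow> (\<forall>j<length cs. c (cs ! j) = 0)"
    by (auto simp: Matrix.vec_eq_iff)
  then show ?thesis
    by (simp add: columns(2)[symmetric] all_set_conv_all_nth)
qed

definition amplitude :: "('v \<Rightarrow> complex ^ 'd) \<Rightarrow> 'v \<times> 'd \<Rightarrow> complex" where
  "amplitude u k = u (fst k) $ snd k"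

lemma conv_wave_field:
  assumes "\<And>\<kappa> n. \<kappa> \<in> F\<^sub>v \<Longrightarrow> u (T n \<kappa>) = monomial (torus_point t) n *s u \<kappa>"
  shows "flex.conv (vertex_coords u) e n = monomial (torus_point t) n *
    (\<Sum>k\<in>F\<^sub>v \<times> UNIV. flex.symbol (torus_point t) e k * amplitude u k)"
proof -
  have "flex.conv (vertex_coords u) e n =
      flex.conv (\<lambda>k n. monomial (torus_point t) n * amplitude u k) e n"
    unfolding flex.conv_def
    by (intro sum.cong refl) (auto simp: vertex_coords_def amplitude_def assms)
  then show ?thesis by (simp add: flex.conv_wave)
qed

lemma amplitude_wave_in_kernel:
  assumes "\<omega> \<in> torus" "u \<in> wave_flexes V E p T F\<^sub>v \<omega>"
  shows "amplitude_vec (amplitude u) \<in> mat_kernel (\<Phi> \<omega>)"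
proof -
  obtain t where t: "\<omega> = torus_point t" using assms(1) by (rule torusE)
  have wave: "\<And>\<kappa> n. \<kappa> \<in> F\<^sub>v \<Longrightarrow> u (T n \<kappa>) = monomial (torus_point t) n *s u \<kappa>"
    and flex: "infinitesimal_flex V E p u"
    using assms(2) by (simp_all add: wave_flexes_def t)
  show ?thesis
    using flex conv_wave_field[OF wave] monomial_torus_nonzero[of t]
    by (simp add: amplitude_vec_in_kernel_iff t infinitesimal_flex_iff)
qed

lemma amplitude_determines_wave:
  assumes u: "u \<in> wave_flexes V E p T F\<^sub>v \<omega>" and w: "w \<in> wave_flexes V E p T F\<^sub>v \<omega>"
    and eq: "\<And>k. k \<in> F\<^sub>v \<times> UNIV \<Longrightarrow> amplitude u k = amplitude w k"
  shows "u = w"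
proof
  fix v
  show "u v = w v"
  proof (cases "v \<in> V")
    case True
    then obtain n \<kappa> where \<kappa>: "\<kappa> \<in> F\<^sub>v" "v = T n \<kappa>" by (rule vertex_cases)
    have "u \<kappa> $ i = w \<kappa> $ i" for i
      using eq[of "(\<kappa>, i)"] \<kappa>(1) by (simp add: amplitude_def)
    then have "u \<kappa> = w \<kappa>"
      by (simp add: Finite_Cartesian_Product.vec_eq_iff)
    then show ?thesis
      using u w \<kappa> by (simp add: wave_flexes_def)
  next
    case False
    then show ?thesis
      using u w by (simp add: wave_flexes_def infinitesimal_flex_def)
  qed
qed

text \<open>
  A wave is determined by its values on the motif, where they can be prescribed freely; whether it is
  a flex is decided by the symbol at its phase factor.
\<close>

lemma kernel_vector_extends_to_wave:
  assumes \<omega>: "\<omega> \<in> torus" and c: "amplitude_vec c \<in> mat_kernel (\<Phi> \<omega>)"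
  obtains u where "u \<in> wave_flexes V E p T F\<^sub>v \<omega>" "\<And>k. k \<in> F\<^sub>v \<times> UNIV \<Longrightarrow> amplitude u k = c k"
proof
  obtain t where t: "\<omega> = torus_point t" using \<omega> by (rule torusE)
  let ?u = "vertex_field (\<lambda>k n. monomial \<omega> n * c k)"
  have at_motif: "?u \<kappa> = (\<chi> i. c (\<kappa>, i))" if "\<kappa> \<in> F\<^sub>v" for \<kappa>
    using vertex_field_translate[OF that, of _ 0] that motif_vertex[OF that]
    by (simp add: action_zero monomial_def)
  show "amplitude ?u k = c k" if "k \<in> F\<^sub>v \<times> UNIV" for k
    using that by (auto simp: amplitude_def at_motif)
  have "?u (T n \<kappa>) = monomial \<omega> n *s ?u \<kappa>" if "\<kappa> \<in> F\<^sub>v" for \<kappa> n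
    using that by (simp add: vertex_field_translate at_motif Finite_Cartesian_Product.vec_eq_iff)
  moreover have "infinitesimal_flex V E p ?u"
    unfolding infinitesimal_flex_iff flex_conv_vertex_field
    using c by (auto simp: vertex_field_def t flex.conv_wave amplitude_vec_in_kernel_iff)
  ultimately show "?u \<in> wave_flexes V E p T F\<^sub>v \<omega>"
    by (simp add: wave_flexes_def)
qed

text \<open>
  Taking amplitudes is an antilinear bijection from the wave flexes to the kernel of the symbol
  matrix. The dimensions agree because a basis of the kernel, with conjugated coefficients in every
  linear combination, lifts to a basis of the space of wave flexes.
\<close>

theorem dim_wave_flexes:
  assumes \<omega>: "\<omega> \<in> torus"
  shows "velocity_fields.dim (wave_flexes V E p T F\<^sub>v \<omega>) = kernel_dim (\<Phi> \<omega>)"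
proof -
  let ?W = "wave_flexes V E p T F\<^sub>v \<omega>"
  interpret kernel "length es" "length cs" "\<Phi> \<omega>"
    by unfold_locales (rule symbol_matrix_carrier)
  obtain C where fin: "finite C" and C: "basis C"
    using kernel_basis_exists[OF symbol_matrix_carrier] by blast
  have CK: "C \<subseteq> mat_kernel (\<Phi> \<omega>)" and indep: "\<not> lin_dep C" and gen: "span C = mat_kernel (\<Phi> \<omega>)"
    using C unfolding Ker.basis_def by auto
  have "\<forall>v\<in>C. \<exists>u. u \<in> ?W \<and> amplitude_vec (amplitude u) = v"
  proof
    fix v assume "v \<in> C"
    then have v: "v \<in> mat_kernel (\<Phi> \<omega>)" using CK by blast
    then have "v \<in> carrier_vec (length cs)" using mat_kernel_carrier[OF symbol_matrix_carrier] by blast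
    then obtain c where c: "v = amplitude_vec c" by (rule amplitude_vec_surj)
    obtain u where u: "u \<in> ?W" "\<And>k. k \<in> F\<^sub>v \<times> UNIV \<Longrightarrow> amplitude u k = c k"
      using kernel_vector_extends_to_wave[OF \<omega>] v unfolding c by blast
    have "cs ! j \<in> F\<^sub>v \<times> UNIV" if "j < length cs" for j
      using that columns by (metis nth_mem)
    then have "amplitude_vec (amplitude u) = v"
      unfolding c by (intro eq_vecI) (simp_all add: u(2))
    then show "\<exists>u. u \<in> ?W \<and> amplitude_vec (amplitude u) = v" using u(1) by blast
  qed
  from bchoice[OF this] obtain g where g: "\<forall>v\<in>C. g v \<in> ?W \<and> amplitude_vec (amplitude (g v)) = v" ..
  have gW: "g ` C \<subseteq> ?W" using g by blast
  have inj: "inj_on g C" using g by (metis inj_onI)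
  have coord: "amplitude (g v) (cs ! j) = cnj (Matrix.vec_index v j)" if "v \<in> C" "j < length cs" for v j
    using g that by (metis amplitude_vec_simps(3) complex_cnj_cnj)
  have amplitude_sum: "amplitude (\<Sum>v\<in>C. scale_field (b v) (g v)) (cs ! j) =
      cnj (Matrix.vec_index (lincomb (\<lambda>v. cnj (b v)) C) j)" if "j < length cs" for b j
  proof -
    have "amplitude (\<Sum>v\<in>C. scale_field (b v) (g v)) (cs ! j) =
        (\<Sum>v\<in>C. b v * amplitude (g v) (cs ! j))"
      using fin by induction (simp_all add: amplitude_def scale_field_def)
    also have "\<dots> = (\<Sum>v\<in>C. b v * cnj (Matrix.vec_index v j))"
      using that by (simp add: coord)
    finally show ?thesis
      using lincomb_index[OF that CK] by simp
  qed
  show ?thesis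
  proof (rule velocity_fields.dim_unique[OF gW])
    show "?W \<subseteq> velocity_fields.span (g ` C)"
    proof
      fix u assume u: "u \<in> ?W"
      have "amplitude_vec (amplitude u) \<in> span C"
        using amplitude_wave_in_kernel[OF \<omega> u] gen by simp
      then obtain b where b: "lincomb b C = amplitude_vec (amplitude u)"
        using Ker.finite_in_span[OF fin CK] by blast
      let ?u = "\<Sum>v\<in>C. scale_field (cnj (b v)) (g v)"
      have "?u \<in> ?W"
        using gW by (intro velocity_fields.subspace_sum velocity_fields.subspace_scale
            subspace_wave_flexes) auto
      moreover have "amplitude ?u k = amplitude u k" if "k \<in> F\<^sub>v \<times> UNIV" for k
      proof -
        have "k \<in> set cs" using that columns(2) by blast
        then obtain j where j: "j < length cs" "k = cs ! j"
          unfolding in_set_conv_nth by blast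
        then show ?thesis
          using amplitude_sum[OF j(1), of "\<lambda>v. cnj (b v)"] by (simp add: b)
      qed
      ultimately have "?u = u"
        using u by (intro amplitude_determines_wave) auto
      moreover have "?u \<in> velocity_fields.span (g ` C)"
        by (intro velocity_fields.span_sum velocity_fields.span_scale velocity_fields.span_base) auto
      ultimately show "u \<in> velocity_fields.span (g ` C)" by simp
    qed
    show "velocity_fields.independent (g ` C)"
    proof
      assume "velocity_fields.dependent (g ` C)"
      then obtain b v where v: "v \<in> C" "b (g v) \<noteq> 0" and "(\<Sum>w\<in>g ` C. scale_field (b w) w) = 0"
        using fin by (auto simp: velocity_fields.dependent_finite)
      then have sum: "(\<Sum>v\<in>C. scale_field (b (g v)) (g v)) = 0"
        by (simp add: sum.reindex[OF inj])
      have "lincomb (\<lambda>v. cnj (b (g v))) C = 0\<^sub>v (length cs)"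
      proof (rule eq_vecI)
        have "lincomb (\<lambda>v. cnj (b (g v))) C \<in> mat_kernel (\<Phi> \<omega>)"
          using CK by (intro Ker.lincomb_closed) auto
        then show dim: "dim_vec (lincomb (\<lambda>v. cnj (b (g v))) C) = dim_vec (0\<^sub>v (length cs))"
          using mat_kernel_carrier[OF symbol_matrix_carrier] by fastforce
        fix j assume "j < dim_vec (0\<^sub>v (length cs) :: complex Matrix.vec)"
        then have j: "j < length cs" by simp
        have "amplitude 0 (cs ! j) = 0" by (simp add: amplitude_def)
        then show "Matrix.vec_index (lincomb (\<lambda>v. cnj (b (g v))) C) j = Matrix.vec_index (0\<^sub>v (length cs)) j"
          using amplitude_sum[OF j, of "\<lambda>v. b (g v)"] j by (simp add: sum)
      qed
      then have "lin_dep C"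
        unfolding Ker.lin_dep_def using fin v
        by (intro exI[of _ C] exI[of _ "\<lambda>v. cnj (b (g v))"] exI[of _ v]) auto
      then show False using indep by simp
    qed
    show "card (g ` C) = kernel_dim (\<Phi> \<omega>)"
      using Ker.dim_basis[OF fin C] by (simp add: card_image[OF inj])
  qed
qed

theorem wave_flex_exists_iff:
  assumes \<omega>: "\<omega> \<in> torus" and square: "length es = length cs"
  shows "(\<exists>u\<in>wave_flexes V E p T F\<^sub>v \<omega>. u \<noteq> 0) \<longleftrightarrow> Determinant.det (\<Phi> \<omega>) = 0"
proof -
  let ?W = "wave_flexes V E p T F\<^sub>v \<omega>"
  have carrier: "\<Phi> \<omega> \<in> carrier_mat (length cs) (length cs)"
    using symbol_matrix_carrier square by simp
  have "Determinant.det (\<Phi> \<omega>) = 0 \<longleftrightarrow> (\<exists>v\<in>mat_kernel (\<Phi> \<omega>). v \<noteq> 0\<^sub>v (length cs))"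
    unfolding det_0_iff_vec_prod_zero_field[OF carrier] mat_kernel[OF carrier] by auto
  also have "\<dots> \<longleftrightarrow> (\<exists>u\<in>?W. u \<noteq> 0)"
  proof
    assume "\<exists>v\<in>mat_kernel (\<Phi> \<omega>). v \<noteq> 0\<^sub>v (length cs)"
    then obtain v where v: "v \<in> mat_kernel (\<Phi> \<omega>)" "v \<noteq> 0\<^sub>v (length cs)" by blast
    then have "v \<in> carrier_vec (length cs)" using mat_kernel_carrier[OF symbol_matrix_carrier] by blast
    then obtain c where c: "v = amplitude_vec c" by (rule amplitude_vec_surj)
    obtain k where k: "k \<in> F\<^sub>v \<times> UNIV" "c k \<noteq> 0"
      using v(2) unfolding c amplitude_vec_zero_iff by blast
    obtain u where u: "u \<in> ?W" "\<And>k. k \<in> F\<^sub>v \<times> UNIV \<Longrightarrow> amplitude u k = c k"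
      using kernel_vector_extends_to_wave[OF \<omega>] v(1) unfolding c by blast
    have "u \<noteq> 0"
      using k u(2)[OF k(1)] by (auto simp: amplitude_def)
    then show "\<exists>u\<in>?W. u \<noteq> 0" using u(1) by blast
  next
    assume "\<exists>u\<in>?W. u \<noteq> 0"
    then obtain u where u: "u \<in> ?W" "u \<noteq> 0" by blast
    have "0 \<in> ?W" by (rule velocity_fields.subspace_0[OF subspace_wave_flexes])
    have "\<not> (\<forall>k\<in>F\<^sub>v \<times> UNIV. amplitude u k = 0)"
    proof
      assume "\<forall>k\<in>F\<^sub>v \<times> UNIV. amplitude u k = 0"
      then have "u = 0"
        using u(1) \<open>0 \<in> ?W\<close> by (intro amplitude_determines_wave) (auto simp: amplitude_def)
      then show False using u(2) by simp
    qed
    then have "amplitude_vec (amplitude u) \<noteq> 0\<^sub>v (length cs)"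
      by (simp add: amplitude_vec_zero_iff)
    then show "\<exists>v\<in>mat_kernel (\<Phi> \<omega>). v \<noteq> 0\<^sub>v (length cs)"
      using amplitude_wave_in_kernel[OF \<omega> u(1)] by blast
  qed
  finally show ?thesis ..
qed

lemma continuous_on_det_symbol:
  assumes square: "length es = length cs"
  shows "continuous_on torus (\<lambda>z. Determinant.det (\<Phi> z))"
proof -
  have entry: "continuous_on torus (\<lambda>z. \<Phi> z $$ (r, c))" if "r < length es" "c < length cs" for r c
  proof -
    have "continuous_on torus (\<lambda>z. symbol_row p T z (es ! r) (fst (cs ! c)) $ snd (cs ! c))"
      unfolding symbol_row_def sum_component vector_smult_component
      by (intro continuous_intros continuous_on_monomial_cnj)
    then show ?thesis using that by (simp add: symbol_matrix_def)
  qed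
  have "Determinant.det (\<Phi> z) = (\<Sum>\<pi> | \<pi> permutes {0..<length es}.
      signof \<pi> * (\<Prod>r = 0..<length es. \<Phi> z $$ (r, \<pi> r)))" for z
    using symbol_matrix_carrier[of z] square by (intro det_def') simp
  moreover have "continuous_on torus (\<lambda>z. \<Sum>\<pi> | \<pi> permutes {0..<length es}.
      signof \<pi> * (\<Prod>r = 0..<length es. \<Phi> z $$ (r, \<pi> r)))"
    using square by (intro continuous_intros entry) (auto dest: permutes_in_image)
  ultimately show ?thesis by simp
qed

text \<open>
  The determinant vanishes only at singular angles, and continuity of the determinant on the torus
  provides the measurability needed to see that they form a null set.
\<close>

theorem AE_full_rank:
  assumes square: "length es = length cs"
    and flexes: "\<And>u. infinitesimal_flex V E p u \<Longrightarrow> finitely_supported u \<Longrightarrow> u = 0"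
  shows "AE z in torus_measure. full_rank (\<Phi> z)"
proof -
  let ?Q = "cbox 0 (\<chi> i. 2 * pi) :: (real ^ 'd) set"
  let ?Z = "{z \<in> torus. Determinant.det (\<Phi> z) = 0}"
  interpret finitely_injective_operator "F\<^sub>v \<times> UNIV" F\<^sub>e motif_shifts rigidity_kernel
    by (rule flex_finitely_injective) (rule flexes)
  have carrier: "\<Phi> z \<in> carrier_mat (length cs) (length cs)" for z
    using symbol_matrix_carrier square by simp
  have "closed ?Z"
    using continuous_closed_preimage_constant[OF continuous_on_det_symbol[OF square] closed_torus] .
  then have Z: "?Z \<in> sets borel" by (rule borel_closed)
  have torus: "(torus :: (complex ^ 'd) set) \<in> sets borel"
    by (rule borel_closed[OF closed_torus])
  have "continuous_on UNIV (torus_point :: real ^ 'd \<Rightarrow> complex ^ 'd)"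
    unfolding torus_point_def by (intro continuous_on_vec_lambda continuous_intros)
  then have meas [measurable]: "(torus_point :: real ^ 'd \<Rightarrow> complex ^ 'd) \<in> borel_measurable borel"
    by (rule borel_measurable_continuous_onI)
  \<comment> \<open>In angle coordinates the zeros of the determinant are singular angles.\<close>
  define A where "A = torus_point -` ?Z"
  have A: "A \<in> sets borel"
    using measurable_sets_borel[OF meas Z] by (simp add: A_def)
  have "A \<subseteq> singular_angles"
  proof
    fix t assume "t \<in> A"
    then have "Determinant.det (\<Phi> (torus_point t)) = 0" by (simp add: A_def)
    then obtain v where v: "v \<in> carrier_vec (length cs)" "v \<noteq> 0\<^sub>v (length cs)" "v \<in> mat_kernel (\<Phi> (torus_point t))"
      unfolding det_0_iff_vec_prod_zero_field[OF carrier] mat_kernel[OF carrier] by auto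
    obtain c where "v = amplitude_vec c" using v(1) by (rule amplitude_vec_surj)
    then show "t \<in> singular_angles"
      using v unfolding singular_angles_def
      by (auto simp: amplitude_vec_in_kernel_iff amplitude_vec_zero_iff)
  qed
  with A have "emeasure lborel (A \<inter> ?Q) = 0"
    by (rule singular_angles_null)
  then have "A \<inter> ?Q \<in> null_sets lborel"
    using A by (intro null_setsI) auto
  then have "AE t in lborel. t \<in> ?Q \<longrightarrow> t \<notin> A"
    by (rule AE_I') auto
  then have "AE t in uniform_measure lborel ?Q. t \<notin> A"
    by (intro AE_uniform_measureI) auto
  then have angles: "AE t in uniform_measure lborel ?Q. torus_point t \<in> torus - ?Z"
    by (simp add: A_def torus_point_in_torus)
  have distr: "torus_measure = distr (uniform_measure lborel ?Q) borel torus_point"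
    by (simp add: torus_measure_def torus_point_def[abs_def])
  have Z': "{z \<in> space borel. z \<in> torus - ?Z} \<in> sets borel"
    using sets.Diff[OF torus Z] by (simp only: space_borel UNIV_I simp_thms Collect_mem_eq)
  have meas': "torus_point \<in> measurable (uniform_measure lborel ?Q) borel"
    using meas by (simp cong: measurable_cong_sets)
  have "AE z in torus_measure. z \<in> torus - ?Z"
    unfolding distr AE_distr_iff[OF meas' Z'] by (rule angles)
  then show ?thesis
  proof eventually_elim
    case (elim z)
    then have "vec_space.rank (length cs) (\<Phi> z) = length cs"
      using vec_space.det_rank_iff[OF carrier] by auto
    then show ?case
      using carrier[of z] by (simp add: full_rank_def)
  qed
qed

end

theorem theorem5p11:
  fixes V :: "'v set"
    and E :: "'v set set"
    and p :: "'v \<Rightarrow> real ^ 'd"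
    and a :: "'d \<Rightarrow> real ^ 'd"
    and T :: "int ^ 'd \<Rightarrow> 'v \<Rightarrow> 'v"
    and F\<^sub>v :: "'v set"
    and F\<^sub>e :: "'v set set"
    and es :: "'v set list"
    and cs :: "('v \<times> 'd) list"
    and \<Phi> :: "complex ^ 'd \<Rightarrow> complex mat"
  assumes crystal: "crystal_framework V E p a T F\<^sub>v F\<^sub>e"
    and rows: "distinct es" "set es = F\<^sub>e"
    and columns: "distinct cs" "set cs = F\<^sub>v \<times> UNIV"
    and symbol: "\<Phi> = symbol_matrix p T es cs"
    and no_internal_stress: "\<And>s. self_stress V E p s \<Longrightarrow> finitely_supported s \<Longrightarrow> s = 0"
    and no_internal_flex: "\<And>u. infinitesimal_flex V E p u \<Longrightarrow> finitely_supported u \<Longrightarrow> u = 0"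
  shows "(CARD('d) * card F\<^sub>v = card F\<^sub>e
        \<and> (\<forall>z\<in>torus. square_mat (\<Phi> z))
        \<and> (AE z in torus_measure. full_rank (\<Phi> z))
        \<and> square_summably_isostatic V E p)
      \<and> (\<forall>\<omega>\<in>torus.
          ((\<exists>u\<in>wave_flexes V E p T F\<^sub>v \<omega>. u \<noteq> 0) \<longleftrightarrow> Determinant.det (\<Phi> \<omega>) = 0)
        \<and> (Determinant.det (\<Phi> \<omega>) = 0 \<longrightarrow>
            velocity_fields.dim (wave_flexes V E p T F\<^sub>v \<omega>) = kernel_dim (\<Phi> \<omega>)))"
proof -
  interpret crystal_framework V E p a T F\<^sub>v F\<^sub>e
    by (rule crystal)
  interpret enumerated_crystal V E p a T F\<^sub>v F\<^sub>e es cs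
    by unfold_locales (rule rows columns)+
  have count: "CARD('d) * card F\<^sub>v = card F\<^sub>e"
    by (rule Maxwell_count[OF no_internal_flex no_internal_stress])
  then have square: "length es = length cs"
    by (simp add: length_es length_cs)
  have matrix: "square_mat (\<Phi> z)" for z
    using symbol_matrix_carrier[of z] square unfolding symbol by simp
  have rank: "AE z in torus_measure. full_rank (\<Phi> z)"
    unfolding symbol by (rule AE_full_rank[OF square no_internal_flex])
  have isostatic: "square_summably_isostatic V E p"
    by (rule square_summably_isostaticI[OF no_internal_flex no_internal_stress])
  show ?thesis
  proof (intro conjI ballI impI)
    fix \<omega> :: "complex ^ 'd" assume "\<omega> \<in> torus"
    then show "(\<exists>u\<in>wave_flexes V E p T F\<^sub>v \<omega>. u \<noteq> 0) \<longleftrightarrow> Determinant.det (\<Phi> \<omega>) = 0"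
      and "velocity_fields.dim (wave_flexes V E p T F\<^sub>v \<omega>) = kernel_dim (\<Phi> \<omega>)"
      unfolding symbol by (rule wave_flex_exists_iff[OF _ square], rule dim_wave_flexes)
  qed (rule count matrix rank isostatic)+
qed

end
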